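(* Let $p\ge1$ be an integer, let $H$ be a Fourier multiplier operator with symbol $\alpha$ on $2L$-periodic functions as described in the context, and let $\phi_c$ be a positive even smooth $2L$-periodic solution of $$cH\phi_c+(c-1)\phi_c-\frac1{p+1}\phi_c^{p+1}=0.$$ Assume that $\widehat{\phi_c}>0$ and that $\widehat{\phi_c^p}\in PF(2)$ discrete. Then the operator $$\mathcal{L}u=cHu+(c-1)u-\phi_c^pu$$ on $L^2_{per}([-L,L])$ has the following properties: $(C_1)$ $\mathcal{L}$ has a unique negative eigenvalue and it is simple; $(C_2)$ the eigenvalue zero of $\mathcal{L}$ is simple.
   Context: Let $L>0$ and $\widehat f(n)=\frac1{2L}\int_{-L}^Lf(x)e^{-in\pi x/L}dx$, $n\in\mathbb{Z}$. $\widehat{\phi_c}>0$ means $\widehat{\phi_c}(n)>0$ for all $n\in\mathbb{Z}$. The operator $H$ is defined by $\widehat{Hu}(n)=\alpha(n)\widehat u(n)$, $n\in\mathbb{Z}$, where $\alpha$ is a real, measurable, locally bounded, even function on $\mathbb{R}$ satisfying $A_1|n|^{m_1}\le\alpha(n)\le A_2(1+|n|)^{m_2}$ for $|n|>n_0$, with $1\le m_1\le m_2$, $A_1,A_2>0$, and $\alpha(n)>b$ for all $n\in\mathbb{Z}$ (for some constant $b$). $\mathcal{L}$ is regarded as a linear, closed, unbounded, self-adjoint operator on a dense domain $D(\mathcal{L})\subset L^2_{per}([-L,L])$; it satisfies $\mathcal{L}\phi_c'=0$. A real sequence $(\alpha_n)_{n\in\mathbb{Z}}$ is in the class $PF(2)$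 discrete if (i) $\alpha_n>0$ for all $n\in\mathbb{Z}$, and (ii) $\alpha_{n_1-m_1}\alpha_{n_2-m_2}-\alpha_{n_1-m_2}\alpha_{n_2-m_1}>0$ for all integers $n_1<n_2$ and $m_1<m_2$. *)

theory Defs
  imports "HOL-Analysis.Analysis"
begin

section \<open>Fourier coefficients and the space of square-integrable periodic functions\<close>

definition fourier_coeff :: "real \<Rightarrow> (real \<Rightarrow> complex) \<Rightarrow> int \<Rightarrow> complex" where
  "fourier_coeff L f n =
     (LINT x:{-L..L}|lebesgue. f x * exp (- (\<i> * of_real (of_int n * pi * x / L)))) / of_real (2 * L)"

text \<open>Elements of L2 are represented by functions; two functions represent the same element
  iff they agree almost everywhere. All notions below respect this identification.\<close>

definition L2_per :: "real \<Rightarrow> (real \<Rightarrow> complex) set" where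
  "L2_per L = {f. f \<in> borel_measurable lebesgue \<and> (\<forall>x. f (x + 2 * L) = f x) \<and>
                  set_integrable lebesgue {-L..L} (\<lambda>x. (cmod (f x))\<^sup>2)}"

definition ae_eq :: "(real \<Rightarrow> complex) \<Rightarrow> (real \<Rightarrow> complex) \<Rightarrow> bool" where
  "ae_eq f g \<longleftrightarrow> (AE x in lebesgue. f x = g x)"


section \<open>Fourier multipliers\<close>

definition admissible_symbol :: "(real \<Rightarrow> real) \<Rightarrow> bool" where
  "admissible_symbol \<alpha> \<longleftrightarrow>
     \<alpha> \<in> borel_measurable lebesgue \<and>
     (\<forall>K. compact K \<longrightarrow> bounded (\<alpha> ` K)) \<and>
     (\<forall>x. \<alpha> (- x) = \<alpha> x) \<and>
     (\<exists>m1 m2 A1 A2 n0. 1 \<le> m1 \<and> m1 \<le> m2 \<and> 0 < A1 \<and> 0 < A2 \<and>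
        (\<forall>n::int. n0 < \<bar>real_of_int n\<bar> \<longrightarrow>
           A1 * \<bar>real_of_int n\<bar> powr m1 \<le> \<alpha> (real_of_int n) \<and>
           \<alpha> (real_of_int n) \<le> A2 * (1 + \<bar>real_of_int n\<bar>) powr m2)) \<and>
     (\<exists>b. \<forall>n::int. b < \<alpha> (real_of_int n))"

definition is_multiplier_image ::
  "real \<Rightarrow> (real \<Rightarrow> real) \<Rightarrow> (real \<Rightarrow> complex) \<Rightarrow> (real \<Rightarrow> complex) \<Rightarrow> bool" where
  "is_multiplier_image L \<alpha> u v \<longleftrightarrow>
     v \<in> L2_per L \<and>
     (\<forall>n. fourier_coeff L v n = of_real (\<alpha> (of_int n)) * fourier_coeff L u n)"

text \<open>The multiplier operator with its maximal (hence self-adjoint) domain. Its value is determined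
  by its Fourier coefficients up to a null set; an arbitrary representative is chosen.\<close>

definition multiplier_domain :: "real \<Rightarrow> (real \<Rightarrow> real) \<Rightarrow> (real \<Rightarrow> complex) set" where
  "multiplier_domain L \<alpha> = {u \<in> L2_per L. \<exists>v. is_multiplier_image L \<alpha> u v}"

definition multiplier :: "real \<Rightarrow> (real \<Rightarrow> real) \<Rightarrow> (real \<Rightarrow> complex) \<Rightarrow> real \<Rightarrow> complex" where
  "multiplier L \<alpha> u = (SOME v. is_multiplier_image L \<alpha> u v)"


section \<open>The travelling wave equation and its linearisation\<close>

definition smooth :: "(real \<Rightarrow> real) \<Rightarrow> bool" where
  "smooth f \<longleftrightarrow> (\<forall>k x. (deriv ^^ k) f differentiable (at x))"

text \<open>For a smooth periodic profile the domain condition is automatic, because the symbol grows at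
  most polynomially; it is listed because the equation refers to the value of the multiplier.\<close>

definition wave_solution ::
  "real \<Rightarrow> (real \<Rightarrow> real) \<Rightarrow> nat \<Rightarrow> real \<Rightarrow> (real \<Rightarrow> real) \<Rightarrow> bool" where
  "wave_solution L \<alpha> p c \<phi> \<longleftrightarrow>
     (\<lambda>x. of_real (\<phi> x)) \<in> multiplier_domain L \<alpha> \<and>
     ae_eq (\<lambda>x. of_real c * multiplier L \<alpha> (\<lambda>x. of_real (\<phi> x)) x + of_real ((c - 1) * \<phi> x)
                - of_real (1 / real (p + 1) * \<phi> x ^ (p + 1)))
           (\<lambda>x. 0)"

text \<open>For a bounded profile and nonzero \<open>c\<close> the maximal domain of this operator is that of the
  multiplier.\<close>

definition linearized_op ::
  "real \<Rightarrow> (real \<Rightarrow> real) \<Rightarrow> nat \<Rightarrow> real \<Rightarrow> (real \<Rightarrow> real) \<Rightarrow> (real \<Rightarrow> complex) \<Rightarrow> real \<Rightarrow> complex" where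
  "linearized_op L \<alpha> p c \<phi> u =
     (\<lambda>x. of_real c * multiplier L \<alpha> u x + of_real (c - 1) * u x - of_real (\<phi> x ^ p) * u x)"

definition PF2_discrete :: "(int \<Rightarrow> real) \<Rightarrow> bool" where
  "PF2_discrete a \<longleftrightarrow>
     (\<forall>n. 0 < a n) \<and>
     (\<forall>n1 n2 m1 m2. n1 < n2 \<and> m1 < m2 \<longrightarrow>
        0 < a (n1 - m1) * a (n2 - m2) - a (n1 - m2) * a (n2 - m1))"


section \<open>Real eigenvalues of an operator on classes of functions modulo null sets\<close>

definition eigenfunction ::
  "(real \<Rightarrow> complex) set \<Rightarrow> ((real \<Rightarrow> complex) \<Rightarrow> real \<Rightarrow> complex) \<Rightarrow> real \<Rightarrow> (real \<Rightarrow> complex) \<Rightarrow> bool" where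
  "eigenfunction D T \<mu> u \<longleftrightarrow>
     u \<in> D \<and> \<not> ae_eq u (\<lambda>x. 0) \<and> ae_eq (T u) (\<lambda>x. of_real \<mu> * u x)"

definition eigenvalue ::
  "(real \<Rightarrow> complex) set \<Rightarrow> ((real \<Rightarrow> complex) \<Rightarrow> real \<Rightarrow> complex) \<Rightarrow> real \<Rightarrow> bool" where
  "eigenvalue D T \<mu> \<longleftrightarrow> (\<exists>u. eigenfunction D T \<mu> u)"

text \<open>The eigenspace, modulo null functions, is one-dimensional over the complex numbers. For a
  self-adjoint operator this is the same as algebraic multiplicity one.\<close>

definition simple_eigenvalue ::
  "(real \<Rightarrow> complex) set \<Rightarrow> ((real \<Rightarrow> complex) \<Rightarrow> real \<Rightarrow> complex) \<Rightarrow> real \<Rightarrow> bool" where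
  "simple_eigenvalue D T \<mu> \<longleftrightarrow>
     (\<exists>u. eigenfunction D T \<mu> u \<and>
          (\<forall>v. eigenfunction D T \<mu> v \<longrightarrow> (\<exists>k::complex. ae_eq v (\<lambda>x. k * u x))))"

end

theory Submission
  imports Defs "HOL-Complex_Analysis.Great_Picard"
begin

text \<open>In Fourier variables the operator is \<open>z \<mapsto> w z - a * z\<close>, where \<open>w n = c \<alpha>(n) + c - 1\<close> and \<open>a\<close> are
  the coefficients of \<open>\<phi>\<^sup>p\<close>. With \<open>f\<close> the coefficients of \<open>\<phi>\<close>, the wave equation and its derivative say
  \<open>a * f = (p + 1) w f\<close> and \<open>a * (n f) = w n f\<close>; since \<open>a\<close> and \<open>f\<close> are positive, this forces \<open>w > 0\<close>
  and \<open>c > 0\<close>. By the PF(2) property the exterior square of the convolution has a kernel that is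
  positive on \<open>n1 < n2\<close>, and it has the explicit positive eigenvector
  \<open>f \<and> n f = (n2 - n1) f(n1) f(n2)\<close>, hence a bounded Rayleigh quotient. Testing it on \<open>f \<and> z\<close> gives
  \<open>\<langle>w f, f\<rangle> \<langle>z, w z - a * z\<rangle> \<ge> - p \<langle>w f, z\<rangle>\<^sup>2\<close>, with equality only if \<open>z / f\<close> is affine. So the form is
  nonnegative on the complement of one vector, which leaves at most one negative eigenvalue, and a
  zero eigenvector is a multiple of \<open>n f\<close>. The form is negative at \<open>f\<close>, and a minimising
  sequence of the Rayleigh quotient converges because \<open>w\<close> grows.\<close>

section \<open>Absolutely convergent sums\<close>

text \<open>Relative to the weight \<open>w\<close>, the convolution has the eigenvector
  \<open>f\<close> with eigenvalue \<open>P = p + 1\<close> and the eigenvector \<open>n f\<close>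
  with eigenvalue 1. A Perron argument on the exterior square shows that its positive eigenvector
  carries its top eigenvalue, which is therefore simple and equal to the product of \<open>P\<close>
  and 1. So 1 is the second eigenvalue of the convolution and is simple: one direction lies above 1,
  which makes the form negative, and exactly one sits at 1, which is the kernel. The wedge
  inequality is this statement in quadratic form. The obstacle is the unbounded weight: pairings and
  exchanges of sums need absolute convergence. Log-concavity makes \<open>a\<close> decay
  geometrically, and every bounded solution of an eigenvalue equation with \<mu> \<le> 0 then gains
  a power of decay each time the equation is applied. As \<open>a\<close> and \<open>w\<close> are
  real, real and imaginary parts of Fourier coefficients solve the same equation, and the sequence
  part stays over the reals.\<close>

lemma summable_on_real_bound:
  fixes f g :: "'a \<Rightarrow> real"
  assumes "g summable_on A" "\<And>x. x \<in> A \<Longrightarrow> \<bar>f x\<bar> \<le> g x"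
  shows "f summable_on A"
  using abs_summable_summable[OF Infinite_Sum.abs_summable_on_comparison_test'[of g A f]] assms by auto

lemma summable_on_bounded_mult:
  fixes f g :: "'a \<Rightarrow> real"
  assumes "g summable_on A" "\<And>x. x \<in> A \<Longrightarrow> \<bar>f x\<bar> \<le> B"
  shows "(\<lambda>x. f x * g x) summable_on A"
proof (rule summable_on_real_bound)
  show "(\<lambda>x. B * \<bar>g x\<bar>) summable_on A"
    using assms(1) summable_on_iff_abs_summable_on_real[of g A] by (intro summable_on_cmult_right) simp
  show "\<bar>f x * g x\<bar> \<le> B * \<bar>g x\<bar>" if "x \<in> A" for x
    using assms(2)[OF that] by (simp add: abs_mult mult_right_mono)
qed

lemma summable_on_imp_bounded:
  fixes f :: "'a \<Rightarrow> real"
  assumes "f summable_on A"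
  shows "\<exists>B. \<forall>x\<in>A. \<bar>f x\<bar> \<le> B"
proof -
  have s: "(\<lambda>x. \<bar>f x\<bar>) summable_on A"
    using assms summable_on_iff_abs_summable_on_real[of f A] by simp
  have "\<bar>f x\<bar> \<le> infsum (\<lambda>x. \<bar>f x\<bar>) A" if "x \<in> A" for x
    using finite_sum_le_infsum[OF s, of "{x}"] that by simp
  thus ?thesis by blast
qed

lemma has_sum_product_UNIV:
  fixes f :: "'a \<Rightarrow> real" and g :: "'b \<Rightarrow> real"
  assumes "f summable_on UNIV" "g summable_on UNIV"
  shows "((\<lambda>(x, y). f x * g y) has_sum (infsum f UNIV * infsum g UNIV)) UNIV"
proof -
  have fa: "(\<lambda>x. \<bar>f x\<bar>) summable_on UNIV" and ga: "(\<lambda>x. \<bar>g x\<bar>) summable_on UNIV"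
    using assms summable_on_iff_abs_summable_on_real[of f] summable_on_iff_abs_summable_on_real[of g]
    by simp_all
  have "(\<lambda>(x, y). \<bar>f x\<bar> * \<bar>g y\<bar>) summable_on UNIV \<times> UNIV"
  proof (rule summable_on_SigmaI)
    show "((\<lambda>y. case (x, y) of (x, y) \<Rightarrow> \<bar>f x\<bar> * \<bar>g y\<bar>) has_sum \<bar>f x\<bar> * infsum (\<lambda>y. \<bar>g y\<bar>) UNIV) UNIV" for x
      using ga by (auto intro!: has_sum_cmult_right)
    show "(\<lambda>x. \<bar>f x\<bar> * infsum (\<lambda>y. \<bar>g y\<bar>) UNIV) summable_on UNIV"
      using fa by (rule summable_on_cmult_left)
  qed auto
  hence s: "(\<lambda>(x, y). f x * g y) summable_on UNIV \<times> UNIV"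
    by (rule summable_on_real_bound) (auto simp: abs_mult)
  have "((\<lambda>(x, y). f x * g y) has_sum (infsum f UNIV * infsum g UNIV)) (UNIV \<times> UNIV)"
  proof (rule has_sum_SigmaI[OF _ _ s])
    show "((\<lambda>y. case (x, y) of (x, y) \<Rightarrow> f x * g y) has_sum f x * infsum g UNIV) UNIV" for x
      using assms by (auto intro!: has_sum_cmult_right)
    show "((\<lambda>x. f x * infsum g UNIV) has_sum infsum f UNIV * infsum g UNIV) UNIV"
      using assms by (intro has_sum_cmult_left) auto
  qed
  thus ?thesis by simp
qed

text \<open>Writing the trial function as \<open>q h\<close>, twice the difference of the two sides is the sum of
  \<open>D x y * h x * h y * (q x - q y)\<^sup>2\<close>.\<close>

lemma ground_state_inequality:
  fixes D :: "'a \<Rightarrow> 'a \<Rightarrow> real"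
  assumes sym: "\<And>x y. D x y = D y x"
    and nonneg: "\<And>x y. 0 \<le> D x y * h x * h y"
    and h: "\<And>x. ((\<lambda>y. D x y * h y) has_sum V x * h x) UNIV"
    and S: "(\<lambda>x. V x * (q x * h x)\<^sup>2) summable_on UNIV"
  shows "(\<lambda>(x, y). D x y * (q x * h x) * (q y * h y)) summable_on UNIV"
    and "infsum (\<lambda>(x, y). D x y * (q x * h x) * (q y * h y)) UNIV
           \<le> infsum (\<lambda>x. V x * (q x * h x)\<^sup>2) UNIV"
    and "infsum (\<lambda>(x, y). D x y * (q x * h x) * (q y * h y)) UNIV
             = infsum (\<lambda>x. V x * (q x * h x)\<^sup>2) UNIV
           \<Longrightarrow> D x y * h x * h y * (q x - q y)\<^sup>2 = 0"
proof -
  define T where "T = (\<lambda>(x, y). D x y * h x * h y * (q x)\<^sup>2)"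
  define T' where "T' = (\<lambda>(x, y). D x y * h x * h y * (q y)\<^sup>2)"
  define X where "X = (\<lambda>(x, y). D x y * (q x * h x) * (q y * h y))"
  have row: "((\<lambda>y. T (x, y)) has_sum V x * (q x * h x)\<^sup>2) UNIV" for x
    using has_sum_cmult_right[OF h[of x], where c = "h x * (q x)\<^sup>2"]
    by (simp add: T_def power2_eq_square mult_ac)
  have Ts: "T summable_on UNIV \<times> UNIV"
    by (rule summable_on_SigmaI[OF row S]) (use nonneg in \<open>auto simp: T_def\<close>)
  have T: "(T has_sum infsum (\<lambda>x. V x * (q x * h x)\<^sup>2) UNIV) (UNIV \<times> UNIV)"
    by (rule has_sum_SigmaI[OF row _ Ts]) (use S in auto)
  have "(\<lambda>(x, y). T (y, x)) = T'"
    by (auto simp: T_def T'_def sym fun_eq_iff mult_ac)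
  hence T': "(T' has_sum infsum (\<lambda>x. V x * (q x * h x)\<^sup>2) UNIV) (UNIV \<times> UNIV)"
    using T has_sum_swap[where f = T and A = UNIV and B = UNIV] by simp
  have eq: "T z + T' z - 2 * X z = (case z of (x, y) \<Rightarrow> D x y * h x * h y * (q x - q y)\<^sup>2)" for z
    by (cases z) (simp add: T_def T'_def X_def power2_eq_square algebra_simps)
  \<comment> \<open>The companion square bounds \<open>X\<close> from below as the first bounds it
    from above; together they dominate \<open>\<bar>X\<bar>\<close> by \<open>T + T'\<close> and
    yield its summability.\<close>
  have eq': "T z + T' z + 2 * X z = (case z of (x, y) \<Rightarrow> D x y * h x * h y * (q x + q y)\<^sup>2)" for z
    by (cases z) (simp add: T_def T'_def X_def power2_eq_square algebra_simps)
  have TT: "(\<lambda>z. T z + T' z) summable_on UNIV \<times> UNIV"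
    using T T' by (intro summable_on_add) (auto dest: has_sum_imp_summable)
  have "\<bar>X z\<bar> \<le> T z + T' z" for z
  proof -
    obtain x y where z: "z = (x, y)" by (cases z)
    have "0 \<le> T z + T' z - 2 * X z" unfolding eq unfolding z using nonneg by simp
    moreover have "0 \<le> T z + T' z + 2 * X z" unfolding eq' unfolding z using nonneg by simp
    ultimately show ?thesis by linarith
  qed
  hence Xs: "X summable_on UNIV \<times> UNIV"
    using TT by (rule_tac summable_on_real_bound) auto
  thus "(\<lambda>(x, y). D x y * (q x * h x) * (q y * h y)) summable_on UNIV"
    by (simp add: X_def)
  define I where "I = infsum (\<lambda>x. V x * (q x * h x)\<^sup>2) UNIV"
  define J where "J = infsum X UNIV"
  have "((\<lambda>z. T z + T' z + (- 2) * X z) has_sum I + I + (-2) * J) (UNIV \<times> UNIV)"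
    unfolding I_def J_def using Xs by (intro has_sum_add T T' has_sum_cmult_right) auto
  hence E: "((\<lambda>(x, y). D x y * h x * h y * (q x - q y)\<^sup>2) has_sum I + I - 2 * J) (UNIV \<times> UNIV)"
    using eq by (subst has_sum_cong[where g="\<lambda>z. T z + T' z + (- 2) * X z"]) auto
  have "0 \<le> I + I - 2 * J"
    by (rule has_sum_nonneg[OF E]) (use nonneg in auto)
  thus "infsum (\<lambda>(x, y). D x y * (q x * h x) * (q y * h y)) UNIV
           \<le> infsum (\<lambda>x. V x * (q x * h x)\<^sup>2) UNIV"
    by (simp add: I_def J_def X_def)
  assume "infsum (\<lambda>(x, y). D x y * (q x * h x) * (q y * h y)) UNIV
             = infsum (\<lambda>x. V x * (q x * h x)\<^sup>2) UNIV"
  hence "I = J" by (simp add: I_def J_def X_def)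
  thus "D x y * h x * h y * (q x - q y)\<^sup>2 = 0"
    using nonneg_has_sum_le_0D[OF E, of "(x, y)"] nonneg by auto
qed

section \<open>Summability over the integers from polynomial decay\<close>

lemma summable_on_intI:
  fixes g :: "int \<Rightarrow> real"
  assumes "summable (\<lambda>n. g (int n))" "summable (\<lambda>n. g (- int n))" "\<And>n. 0 \<le> g n"
  shows "g summable_on UNIV"
proof -
  have 1: "g summable_on range int"
    using summable_nonneg_imp_summable_on[OF assms(1)] assms(3)
    by (subst summable_on_reindex) (auto simp: o_def)
  have 2: "g summable_on range (\<lambda>n. - int n)"
    using summable_nonneg_imp_summable_on[OF assms(2)] assms(3)
    by (subst summable_on_reindex) (auto simp: o_def inj_def)
  have "UNIV = range int \<union> range (\<lambda>n. - int n)"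
    by (metis (no_types) UNIV_eq_I UnCI int_cases2 rangeI)
  thus ?thesis using summable_on_union[OF 1 2] by metis
qed

lemma summable_on_inverse_square_int:
  "(\<lambda>n::int. 1 / (1 + \<bar>real_of_int n\<bar>)\<^sup>2) summable_on UNIV"
proof (rule summable_on_intI)
  have "summable (\<lambda>n. 1 / (real (Suc n))\<^sup>2)"
    using summable_Suc_iff[of "\<lambda>n. inverse (real n ^ 2)"] inverse_power_summable[of 2, where 'a=real]
    by (simp add: inverse_eq_divide)
  thus "summable (\<lambda>n. 1 / (1 + \<bar>real_of_int (int n)\<bar>)\<^sup>2)"
    "summable (\<lambda>n. 1 / (1 + \<bar>real_of_int (- int n)\<bar>)\<^sup>2)"
    by (simp_all add: add.commute)
qed auto

lemma summable_on_int_decay: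
  fixes z :: "int \<Rightarrow> real"
  assumes "\<And>n. \<bar>z n\<bar> * (1 + \<bar>real_of_int n\<bar>)\<^sup>2 \<le> M"
  shows "z summable_on UNIV"
proof (rule summable_on_real_bound)
  show "(\<lambda>n::int. M * (1 / (1 + \<bar>real_of_int n\<bar>)\<^sup>2)) summable_on UNIV"
    by (intro summable_on_cmult_right summable_on_inverse_square_int)
  show "\<bar>z n\<bar> \<le> M * (1 / (1 + \<bar>real_of_int n\<bar>)\<^sup>2)" for n
    using assms[of n] by (simp add: pos_le_divide_eq add_pos_nonneg)
qed

section \<open>Sequences with a totally positive convolution kernel\<close>

text \<open>Minors on adjacent rows and columns are the strict log-concavity inequalities, so ratios
  of consecutive terms decrease along the nonnegative integers. Centred at 0, log-concavity and
  evenness give \<open>a 1 < a 0\<close>, so already the first ratio \<open>\<rho>\<close> is below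
  1.\<close>

lemma PF2_geometric_decay:
  assumes "PF2_discrete a" and even: "\<And>n. a (- n) = a n"
  shows "\<exists>\<rho>. 0 < \<rho> \<and> \<rho> < 1 \<and> (\<forall>n. a n \<le> a 0 * \<rho> ^ nat \<bar>n\<bar>)"
proof -
  have pos: "0 < a n" for n
    using assms by (simp add: PF2_discrete_def)
  have lc: "a n * a (n + 2) < (a (n + 1))\<^sup>2" for n
  proof -
    have "0 < a ((n+1) - 0) * a ((n+2) - 1) - a ((n+1) - 1) * a ((n+2) - 0)"
      using assms(1) unfolding PF2_discrete_def by (metis add_less_cancel_left one_less_numeral_iff semiring_norm(76) zero_less_one)
    thus ?thesis by (simp add: power2_eq_square add.commute)
  qed
  define \<rho> where "\<rho> = a 1 / a 0"
  have "a 1 * a 1 < a 0 * a 0"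
    using lc[of "-1"] even[of 1] by (simp add: power2_eq_square)
  hence "a 1 < a 0"
    using pos[of 0] pos[of 1] by (meson less_le_not_le linorder_not_less mult_mono)
  hence \<rho>: "0 < \<rho>" "\<rho> < 1"
    using pos by (auto simp: \<rho>_def)
  have step: "a (int n + 1) \<le> \<rho> * a (int n)" for n
  proof (induction n)
    case 0
    show ?case using pos[of 0] by (simp add: \<rho>_def)
  next
    case (Suc n)
    have "a (int n) * a (int n + 2) \<le> a (int n + 1) * a (int n + 1)"
      using lc[of "int n"] by (simp add: power2_eq_square)
    also have "\<dots> \<le> \<rho> * a (int n) * a (int n + 1)"
      using Suc pos by (intro mult_right_mono) (auto intro: less_imp_le)
    finally have "a (int n) * a (int n + 2) \<le> a (int n) * (\<rho> * a (int n + 1))"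
      by (simp add: mult_ac)
    thus ?case using pos[of "int n"] by (simp add: algebra_simps)
  qed
  have nat: "a (int n) \<le> a 0 * \<rho> ^ n" for n
  proof (induction n)
    case (Suc n)
    have "a (int (Suc n)) \<le> \<rho> * a (int n)" using step[of n] by (simp add: add.commute)
    also have "\<dots> \<le> \<rho> * (a 0 * \<rho> ^ n)" using Suc \<rho> by simp
    finally show ?case by (simp add: mult_ac)
  qed simp
  have "a n \<le> a 0 * \<rho> ^ nat \<bar>n\<bar>" for n
  proof (cases "n \<ge> 0")
    case True thus ?thesis using nat[of "nat n"] by simp
  next
    case False thus ?thesis using nat[of "nat (- n)"] even[of n] by simp
  qed
  thus ?thesis using \<rho> by blast
qed

text \<open>Writing \<open>\<rho>\<close> as \<open>\<sigma> ^ Suc j\<close> gives each factor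
  \<open>1 + real n\<close> its own \<open>\<sigma> ^ n\<close>. Bernoulli's inequality for
  \<open>1 / \<sigma> = 1 + d\<close> then bounds each such product by
  \<open>1 / min 1 d\<close>.\<close>

lemma polynomial_times_geometric_bounded:
  assumes "0 < \<rho>" "\<rho> < (1::real)"
  shows "\<exists>M. \<forall>n. (1 + real n) ^ Suc j * \<rho> ^ n \<le> M"
proof -
  define \<sigma> where "\<sigma> = root (Suc j) \<rho>"
  have \<sigma>: "0 < \<sigma>" "\<sigma> < 1" "\<sigma> ^ Suc j = \<rho>"
    using assms real_root_less_iff[of "Suc j" \<rho> 1]
    by (auto simp: \<sigma>_def real_root_gt_zero simp del: power_Suc)
  define d where "d = 1 / \<sigma> - 1"
  have d: "0 < d" "1 / \<sigma> = 1 + d" using \<sigma> by (auto simp: d_def)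
  have "(1 + real n) * \<sigma> ^ n \<le> 1 / min 1 d" for n
  proof -
    have "min 1 d * (1 + real n) \<le> 1 + real n * d"
      using d using mult_right_mono[of 1 d "real n"] mult_right_mono[of d 1 "real n"]
      by (auto simp: min_def algebra_simps)
    also have "\<dots> \<le> (1 + d) ^ n"
      using d Bernoulli_inequality[of d n] by (simp add: mult.commute)
    also have "\<dots> = 1 / \<sigma> ^ n"
      using d by (metis power_one_over)
    finally show ?thesis using \<sigma> d by (simp add: field_simps)
  qed
  hence "((1 + real n) * \<sigma> ^ n) ^ Suc j \<le> (1 / min 1 d) ^ Suc j" for n
    using \<sigma> by (intro power_mono) auto
  moreover have "((1 + real n) * \<sigma> ^ n) ^ Suc j = (1 + real n) ^ Suc j * \<rho> ^ n" for n
    using \<sigma>(3) by (metis power_mult_distrib power_commutes power_mult mult.commute)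
  ultimately show ?thesis by metis
qed

lemma PF2_moment_summable:
  assumes "PF2_discrete a" and even: "\<And>n. a (- n) = a n"
  shows "(\<lambda>n. a n * (1 + \<bar>real_of_int n\<bar>) ^ j) summable_on UNIV"
proof -
  obtain \<rho> where \<rho>: "0 < \<rho>" "\<rho> < 1" "\<And>n. a n \<le> a 0 * \<rho> ^ nat \<bar>n\<bar>"
    using PF2_geometric_decay[OF assms] by blast
  \<comment> \<open>The two powers beyond \<open>j\<close> pay for the comparison with the inverse
    squares.\<close>
  obtain M where M: "\<And>n. (1 + real n) ^ Suc (Suc j) * \<rho> ^ n \<le> M"
    using polynomial_times_geometric_bounded[OF \<rho>(1,2)] by blast
  have pos: "0 < a n" for n
    using assms by (simp add: PF2_discrete_def)
  show ?thesis
  proof (rule summable_on_int_decay)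
    fix n :: int
    have n: "\<bar>real_of_int n\<bar> = real (nat \<bar>n\<bar>)" by simp
    have "\<bar>a n * (1 + \<bar>real_of_int n\<bar>) ^ j\<bar> * (1 + \<bar>real_of_int n\<bar>)\<^sup>2
        = a n * (1 + \<bar>real_of_int n\<bar>) ^ Suc (Suc j)"
      using pos[of n] by (simp add: power2_eq_square mult_ac abs_mult)
    also have "\<dots> \<le> (a 0 * \<rho> ^ nat \<bar>n\<bar>) * (1 + \<bar>real_of_int n\<bar>) ^ Suc (Suc j)"
      by (intro mult_right_mono \<rho>(3)) simp
    also have "\<dots> = a 0 * ((1 + real (nat \<bar>n\<bar>)) ^ Suc (Suc j) * \<rho> ^ nat \<bar>n\<bar>)"
      unfolding n by (simp only: mult_ac)
    also have "\<dots> \<le> a 0 * M"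
      using pos[of 0] by (intro mult_left_mono M) simp
    finally show "\<bar>a n * (1 + \<bar>real_of_int n\<bar>) ^ j\<bar> * (1 + \<bar>real_of_int n\<bar>)\<^sup>2 \<le> a 0 * M" .
  qed
qed

section \<open>Gain of decay in convolution equations\<close>

lemma bij_int_minus: "bij_betw (\<lambda>k. n - k) UNIV (UNIV :: int set)"
  by (rule bij_betwI[where g="\<lambda>k. n - k"]) auto

text \<open>The weight \<open>(1 + \<bar>n\<bar>) ^ j\<close> is submultiplicative, so convolution
  with \<open>a\<close>, all of whose moments are finite, preserves decay of order \<open>j\<close>.
  Dividing by \<open>W\<close>, which grows at least linearly, gains one more power.\<close>

lemma convolution_bootstrap:
  assumes PF2: "PF2_discrete a" and even: "\<And>n. a (- n) = a n"
    and C: "0 < C" "\<And>n. C * (1 + \<bar>real_of_int n\<bar>) \<le> W n"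
    and eq: "\<And>n. ((\<lambda>k. a (n - k) * z k) has_sum (W n * z n)) UNIV"
    and bdd: "\<And>n. \<bar>z n\<bar> \<le> B"
  shows "\<exists>M. \<forall>n. \<bar>z n\<bar> * (1 + \<bar>real_of_int n\<bar>) ^ j \<le> M"
proof (induction j)
  case 0
  show ?case using bdd by auto
next
  case (Suc j)
  then obtain M where M: "\<And>n. \<bar>z n\<bar> * (1 + \<bar>real_of_int n\<bar>) ^ j \<le> M" by blast
  have pos: "0 < a n" for n
    using PF2 by (simp add: PF2_discrete_def)
  define K where "K = infsum (\<lambda>n. a n * (1 + \<bar>real_of_int n\<bar>) ^ j) UNIV"
  have "\<bar>z n\<bar> * (1 + \<bar>real_of_int n\<bar>) ^ Suc j \<le> K * M / C" for n
  proof -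
    let ?p = "\<lambda>k. (1 + \<bar>real_of_int k\<bar>) ^ j"
    have K: "((\<lambda>k. a (n - k) * ?p (n - k) * M) has_sum K * M) UNIV"
      unfolding K_def
      by (intro has_sum_cmult_left)
         (use PF2_moment_summable[OF PF2 even, of j] in
           \<open>subst has_sum_reindex_bij_betw[OF bij_int_minus, where f="\<lambda>k. a k * ?p k"]; simp\<close>)
    have p: "?p n \<le> ?p (n - k) * ?p k" for k
    proof -
      have "1 + \<bar>real_of_int n\<bar> \<le> (1 + \<bar>real_of_int (n - k)\<bar>) + \<bar>real_of_int k\<bar>"
        by simp
      also have "\<dots> \<le> (1 + \<bar>real_of_int (n - k)\<bar>) * (1 + \<bar>real_of_int k\<bar>)"
        by (simp add: algebra_simps)
      finally show ?thesis
        unfolding power_mult_distrib[symmetric] by (intro power_mono) auto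
    qed
    have L: "((\<lambda>k. a (n - k) * z k * ?p n) has_sum W n * z n * ?p n) UNIV"
      by (intro has_sum_cmult_left eq)
    have b: "norm (a (n - k) * z k * ?p n) \<le> a (n - k) * ?p (n - k) * M" for k
    proof -
      have "norm (a (n - k) * z k * ?p n) = a (n - k) * \<bar>z k\<bar> * ?p n"
        using pos[of "n - k"] by (simp add: abs_mult)
      also have "\<dots> \<le> a (n - k) * \<bar>z k\<bar> * (?p (n - k) * ?p k)"
        using pos by (intro mult_left_mono p) (auto simp: less_imp_le)
      also have "\<dots> = a (n - k) * ?p (n - k) * (\<bar>z k\<bar> * ?p k)" by simp
      also have "\<dots> \<le> a (n - k) * ?p (n - k) * M"
        using pos by (intro mult_left_mono M) (auto simp: less_imp_le)
      finally show ?thesis .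
    qed
    have "norm (W n * z n * ?p n) \<le> K * M"
      by (rule norm_infsum_le[OF L K b])
    hence u: "\<bar>W n\<bar> * (\<bar>z n\<bar> * ?p n) \<le> K * M"
      by (simp add: abs_mult mult_ac)
    have "C * (1 + \<bar>real_of_int n\<bar>) * (\<bar>z n\<bar> * ?p n) \<le> \<bar>W n\<bar> * (\<bar>z n\<bar> * ?p n)"
      using C(2)[of n] by (intro mult_right_mono) auto
    hence "C * (1 + \<bar>real_of_int n\<bar>) * (\<bar>z n\<bar> * ?p n) \<le> K * M"
      using u by linarith
    thus ?thesis using C(1) by (simp add: pos_le_divide_eq mult_ac)
  qed
  thus ?case by blast
qed

section \<open>The wedge inequality\<close>

text \<open>In the application \<open>a\<close> and \<open>f\<close> are the Fourier coefficients of \<open>\<phi>\<^sup>p\<close> and \<open>\<phi>\<close>, \<open>P = p + 1\<close>, and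
  \<open>w n = c \<alpha>(n) + c - 1\<close>. The two convolution identities are the wave equation and its derivative,
  and \<open>w z - a * z\<close>, called \<open>res z\<close> below, is the linearised operator.\<close>

locale wave_sequences =
  fixes a w f :: "int \<Rightarrow> real" and P C B :: real
  assumes PF2: "PF2_discrete a"
    and a_even: "\<And>n. a (- n) = a n"
    and C_pos: "0 < C" and w_ge: "\<And>n. C * (1 + \<bar>real_of_int n\<bar>) \<le> w n"
    and P_gt: "1 < P"
    and f_pos: "\<And>n. 0 < f n" and f_bdd: "\<And>n. f n \<le> B"
    and conv_f: "\<And>n. ((\<lambda>k. a (n - k) * f k) has_sum (P * w n * f n)) UNIV"
    and conv_df: "\<And>n. ((\<lambda>k. a (n - k) * (real_of_int k * f k)) has_sum
                        (w n * (real_of_int n * f n))) UNIV"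
begin

lemma a_pos: "0 < a n"
  using PF2 by (simp add: PF2_discrete_def)

lemma a_minor: "n1 < n2 \<Longrightarrow> m1 < m2 \<Longrightarrow> a (n1 - m2) * a (n2 - m1) < a (n1 - m1) * a (n2 - m2)"
  using PF2 by (simp add: PF2_discrete_def)

lemma a_swap: "a (n - k) = a (k - n)"
  by (metis a_even minus_diff_eq)

lemma a_summable: "a summable_on UNIV"
  using PF2_moment_summable[OF PF2 a_even, of 0] by simp

lemma w_pos: "0 < w n"
  by (rule less_le_trans[OF _ w_ge]) (use C_pos in simp)

lemma a_row: "((\<lambda>k. a (n - k)) has_sum infsum a UNIV) UNIV"
  using a_summable by (subst has_sum_reindex_bij_betw[OF bij_int_minus]) simp

text \<open>Only \<open>z\<close> is summable, \<open>x\<close> is merely bounded. Summing over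
  \<open>n\<close> first works because every column of the kernel has the same total mass
  \<open>infsum a UNIV\<close>. This licenses the later exchanges of summation.\<close>

lemma kernel_summable:
  assumes z: "z summable_on UNIV" and x: "\<And>n. \<bar>x n\<bar> \<le> X"
  shows "(\<lambda>(n, k). x n * (a (n - k) * z k)) summable_on UNIV"
proof -
  have za: "(\<lambda>k. \<bar>z k\<bar>) summable_on UNIV"
    using z summable_on_iff_abs_summable_on_real[of z] by simp
  have col: "((\<lambda>n. a (n - k)) has_sum infsum a UNIV) UNIV" for k
    using a_row[of k] by (simp add: a_swap[of _ k])
  have "(\<lambda>(k, n). X * (a (n - k) * \<bar>z k\<bar>)) summable_on UNIV \<times> UNIV"
  proof (rule summable_on_SigmaI)
    show "((\<lambda>n. case (k, n) of (k, n) \<Rightarrow> X * (a (n - k) * \<bar>z k\<bar>)) has_sum X * (infsum a UNIV * \<bar>z k\<bar>)) UNIV" for k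
      using col by (auto intro!: has_sum_cmult_right has_sum_cmult_left)
    show "(\<lambda>k. X * (infsum a UNIV * \<bar>z k\<bar>)) summable_on UNIV"
      by (intro summable_on_cmult_right za)
    show "0 \<le> (case (k, n) of (k, n) \<Rightarrow> X * (a (n - k) * \<bar>z k\<bar>))" for k n
      using x[of 0] a_pos[of "n - k"] by simp
  qed
  hence "(\<lambda>(n, k). X * (a (n - k) * \<bar>z k\<bar>)) summable_on UNIV \<times> UNIV"
    by (subst summable_on_swap) (simp add: case_prod_unfold)
  hence "(\<lambda>(n, k). x n * (a (n - k) * z k)) summable_on UNIV \<times> UNIV"
  proof (rule summable_on_real_bound, clarify)
    fix n k
    show "\<bar>x n * (a (n - k) * z k)\<bar> \<le> X * (a (n - k) * \<bar>z k\<bar>)"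
      using x[of n] a_pos[of "n - k"] by (simp add: abs_mult mult_right_mono)
  qed
  thus ?thesis by simp
qed

definition conv :: "(int \<Rightarrow> real) \<Rightarrow> int \<Rightarrow> real" where
  "conv z n = infsum (\<lambda>k. a (n - k) * z k) UNIV"

lemma conv_has_sum:
  assumes "z summable_on UNIV"
  shows "((\<lambda>k. a (n - k) * z k) has_sum conv z n) UNIV"
proof -
  have "(\<lambda>k. a (n - k) * z k) summable_on UNIV"
    using summable_on_imp_bounded[OF a_summable] by (auto intro: summable_on_bounded_mult[OF assms])
  thus ?thesis by (simp add: conv_def)
qed

lemma conv_eqI: "((\<lambda>k. a (n - k) * z k) has_sum s) UNIV \<Longrightarrow> conv z n = s"
  unfolding conv_def by (rule infsumI)

lemma conv_summable:
  assumes "z summable_on UNIV"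
  shows "conv z summable_on UNIV"
proof -
  have "(\<lambda>(n, k). a (n - k) * z k) summable_on UNIV \<times> UNIV"
    using kernel_summable[OF assms, of "\<lambda>_. 1" 1] by simp
  thus ?thesis unfolding conv_def by (rule summable_on_Sigma_banach)
qed

text \<open>An \<open>infsum\<close> without summability is 0, so additivity of this pairing
  requires summable arguments, whereas symmetry and scaling hold for all sequences.\<close>

definition ip :: "(int \<Rightarrow> real) \<Rightarrow> (int \<Rightarrow> real) \<Rightarrow> real" where
  "ip x y = infsum (\<lambda>n. x n * y n) UNIV"

lemma ip_has_sum:
  assumes "x summable_on UNIV" "y summable_on UNIV"
  shows "((\<lambda>n. x n * y n) has_sum ip x y) UNIV"
  using summable_on_imp_bounded[OF assms(1)]
  by (auto simp: ip_def intro!: has_sum_infsum intro: summable_on_bounded_mult[OF assms(2)])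

lemma ip_commute: "ip x y = ip y x"
  by (simp add: ip_def mult.commute)

lemma ip_lincomb:
  assumes "x summable_on UNIV" "y summable_on UNIV" "z summable_on UNIV"
  shows "ip x (\<lambda>n. s * y n + t * z n) = s * ip x y + t * ip x z"
    and "ip (\<lambda>n. s * y n + t * z n) x = s * ip y x + t * ip z x"
proof -
  have "((\<lambda>n. s * (x n * y n) + t * (x n * z n)) has_sum s * ip x y + t * ip x z) UNIV"
    by (intro has_sum_add has_sum_cmult_right ip_has_sum assms)
  hence "infsum (\<lambda>n. s * (x n * y n) + t * (x n * z n)) UNIV = s * ip x y + t * ip x z"
    by (rule infsumI)
  thus "ip x (\<lambda>n. s * y n + t * z n) = s * ip x y + t * ip x z"
    by (simp add: ip_def algebra_simps)
  thus "ip (\<lambda>n. s * y n + t * z n) x = s * ip y x + t * ip z x"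
    by (simp add: ip_commute)
qed

lemma ip_conv_double_sum:
  assumes x: "x summable_on UNIV" and z: "z summable_on UNIV"
  shows "ip x (conv z) = infsum (\<lambda>(n, k). x n * (a (n - k) * z k)) (UNIV \<times> UNIV)"
proof -
  obtain X where X: "\<And>n. \<bar>x n\<bar> \<le> X"
    using summable_on_imp_bounded[OF x] by auto
  have s: "(\<lambda>(n, k). x n * (a (n - k) * z k)) summable_on UNIV \<times> UNIV"
    using kernel_summable[OF z X] by simp
  have "infsum (\<lambda>k. x n * (a (n - k) * z k)) UNIV = x n * conv z n" for n
    unfolding conv_def by (rule infsum_cmult_right')
  thus ?thesis
    unfolding ip_def infsum_Sigma'_banach[OF s, symmetric] by simp
qed

lemma ip_conv:
  assumes x: "x summable_on UNIV" and z: "z summable_on UNIV"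
  shows "ip x (conv z) = ip (conv x) z"
proof -
  have "infsum (\<lambda>(n, k). x n * (a (n - k) * z k)) (UNIV \<times> UNIV)
      = infsum (\<lambda>(n, k). z n * (a (n - k) * x k)) (UNIV \<times> UNIV)"
    by (rule infsum_reindex_bij_witness[where i="\<lambda>(n, k). (k, n)" and j="\<lambda>(n, k). (k, n)"])
       (auto simp: a_swap mult_ac)
  thus ?thesis
    using ip_conv_double_sum[OF x z] ip_conv_double_sum[OF z x] by (simp add: ip_commute)
qed

text \<open>Summability of \<open>z\<close> and \<open>w z\<close> makes both bounded too, so all
  pairings among \<open>z\<close>, \<open>w z\<close>, \<open>conv z\<close> and
  \<open>res z\<close> converge absolutely. This is smaller than the natural domain of the quadratic
  form, which asks for \<open>w z\<^sup>2\<close> only, but it contains every bounded solution of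
  the equations studied here.\<close>

definition form_domain :: "(int \<Rightarrow> real) set" where
  "form_domain = {z. z summable_on UNIV \<and> (\<lambda>n. w n * z n) summable_on UNIV}"

definition res :: "(int \<Rightarrow> real) \<Rightarrow> int \<Rightarrow> real" where
  "res z n = w n * z n - conv z n"

lemma form_domainD:
  assumes "z \<in> form_domain"
  shows "z summable_on UNIV" "(\<lambda>n. w n * z n) summable_on UNIV" "res z summable_on UNIV"
proof -
  show z: "z summable_on UNIV" "(\<lambda>n. w n * z n) summable_on UNIV"
    using assms by (auto simp: form_domain_def)
  show "res z summable_on UNIV"
    using summable_on_add[OF z(2) summable_on_uminus[THEN iffD2, OF conv_summable[OF z(1)]]]
    by (simp add: res_def[abs_def])
qed

lemma form_domain_lincomb:
  assumes "y \<in> form_domain" "z \<in> form_domain"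
  shows "(\<lambda>n. s * y n + t * z n) \<in> form_domain"
proof -
  have "(\<lambda>n. s * (w n * y n) + t * (w n * z n)) summable_on UNIV"
    by (intro summable_on_add summable_on_cmult_right form_domainD assms)
  moreover have "(\<lambda>n. s * y n + t * z n) summable_on UNIV"
    by (intro summable_on_add summable_on_cmult_right form_domainD assms)
  ultimately show ?thesis by (simp add: form_domain_def algebra_simps)
qed

lemma res_lincomb:
  assumes "y \<in> form_domain" "z \<in> form_domain"
  shows "res (\<lambda>n. s * y n + t * z n) = (\<lambda>n. s * res y n + t * res z n)"
proof
  fix n
  have "((\<lambda>k. s * (a (n - k) * y k) + t * (a (n - k) * z k)) has_sum s * conv y n + t * conv z n) UNIV"
    by (intro has_sum_add has_sum_cmult_right conv_has_sum form_domainD assms)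
  hence "conv (\<lambda>k. s * y k + t * z k) n = s * conv y n + t * conv z n"
    by (intro conv_eqI) (simp add: algebra_simps)
  thus "res (\<lambda>n. s * y n + t * z n) n = s * res y n + t * res z n"
    by (simp add: res_def algebra_simps)
qed

lemma ip_res_commute:
  assumes "y \<in> form_domain" "z \<in> form_domain"
  shows "ip y (res z) = ip (res y) z"
proof -
  have 1: "ip y (res z) = ip y (\<lambda>n. w n * z n) - ip y (conv z)"
    using ip_lincomb(1)[of y "\<lambda>n. w n * z n" "conv z" 1 "-1"] form_domainD[OF assms(1)] form_domainD[OF assms(2)]
    by (simp add: res_def[abs_def] conv_summable)
  have 2: "ip (res y) z = ip (\<lambda>n. w n * y n) z - ip (conv y) z"
    using ip_lincomb(2)[of z "\<lambda>n. w n * y n" "conv y" 1 "-1"] form_domainD[OF assms(1)] form_domainD[OF assms(2)]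
    by (simp add: res_def[abs_def] conv_summable)
  have "ip y (\<lambda>n. w n * z n) = ip (\<lambda>n. w n * y n) z"
    by (simp add: ip_def mult_ac)
  thus ?thesis using 1 2 ip_conv form_domainD assms by simp
qed

text \<open>\<open>W\<close> is kept apart from \<open>w\<close> to serve two equations:
  \<open>W = P * w\<close> for \<open>f\<close>, and \<open>W = w - \<mu>\<close> for
  eigensequences. The constant \<open>D\<close> compares the two weights.\<close>

lemma bounded_solution_form_domain:
  assumes "0 < C'" "\<And>n. C' * (1 + \<bar>real_of_int n\<bar>) \<le> W n"
    and eq: "\<And>n. ((\<lambda>k. a (n - k) * z k) has_sum (W n * z n)) UNIV"
    and bdd: "\<And>n. \<bar>z n\<bar> \<le> Z"
    and w: "\<And>n. \<bar>w n\<bar> \<le> D * \<bar>W n\<bar>"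
  shows "z \<in> form_domain" "\<exists>M. \<forall>n. \<bar>z n\<bar> * (1 + \<bar>real_of_int n\<bar>) ^ j \<le> M"
proof -
  have dec: "\<exists>M. \<forall>n. \<bar>z n\<bar> * (1 + \<bar>real_of_int n\<bar>) ^ j \<le> M" for j
    by (rule convolution_bootstrap[OF PF2 a_even assms(1,2) eq bdd])
  thus "\<exists>M. \<forall>n. \<bar>z n\<bar> * (1 + \<bar>real_of_int n\<bar>) ^ j \<le> M" by blast
  obtain M where M: "\<And>n. \<bar>z n\<bar> * (1 + \<bar>real_of_int n\<bar>) ^ 2 \<le> M"
    using dec by blast
  have z: "z summable_on UNIV"
    by (rule summable_on_int_decay[OF M])
  \<comment> \<open>The locale bounds \<open>w\<close> only from below, so decay of \<open>z\<close>
    does not control \<open>w z\<close>; the equation does, since it identifies \<open>W z\<close>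
    with a convolution of summable sequences.\<close>
  have "(\<lambda>n. W n * z n) = conv z"
    using conv_eqI[OF eq] by auto
  hence "(\<lambda>n. W n * z n) summable_on UNIV"
    using conv_summable[OF z] by simp
  hence "(\<lambda>n. \<bar>W n * z n\<bar>) summable_on UNIV"
    using summable_on_iff_abs_summable_on_real[of "\<lambda>n. W n * z n"] by simp
  hence "(\<lambda>n. D * \<bar>W n * z n\<bar>) summable_on UNIV"
    by (rule summable_on_cmult_right)
  hence "(\<lambda>n. w n * z n) summable_on UNIV"
  proof (rule summable_on_real_bound)
    show "\<bar>w n * z n\<bar> \<le> D * \<bar>W n * z n\<bar>" for n
      using mult_right_mono[OF w[of n], of "\<bar>z n\<bar>"] by (simp add: abs_mult mult_ac)
  qed
  thus "z \<in> form_domain" using z by (simp add: form_domain_def)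
qed

abbreviation df :: "int \<Rightarrow> real" where
  "df n \<equiv> real_of_int n * f n"

lemma f_form_domain: "f \<in> form_domain" and f_decay: "\<exists>M. \<forall>n. \<bar>f n\<bar> * (1 + \<bar>real_of_int n\<bar>) ^ j \<le> M"
proof -
  have 1: "0 < P * C" "\<And>n. P * C * (1 + \<bar>real_of_int n\<bar>) \<le> P * w n"
    using P_gt C_pos w_ge by (auto simp: mult.assoc)
  have 2: "\<bar>f n\<bar> \<le> B" for n using f_pos[of n] f_bdd[of n] by simp
  have 3: "\<bar>w n\<bar> \<le> (1 / P) * \<bar>P * w n\<bar>" for n
    using P_gt by (simp add: abs_mult)
  show "f \<in> form_domain" "\<exists>M. \<forall>n. \<bar>f n\<bar> * (1 + \<bar>real_of_int n\<bar>) ^ j \<le> M"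
    using bounded_solution_form_domain[OF 1 conv_f 2 3] by blast+
qed

text \<open>Subtracting \<mu> \<le> 0 can only enlarge the weight, so the coercivity bound survives.
  The value \<mu> = 0 is included, which covers \<open>df\<close> and the kernel.\<close>

lemma negative_solution_form_domain:
  assumes "\<mu> \<le> 0" "\<And>n. ((\<lambda>k. a (n - k) * z k) has_sum ((w n - \<mu>) * z n)) UNIV"
    "\<And>n. \<bar>z n\<bar> \<le> Z"
  shows "z \<in> form_domain" "res z = (\<lambda>n. \<mu> * z n)"
proof -
  have 1: "C * (1 + \<bar>real_of_int n\<bar>) \<le> w n - \<mu>" for n
    using w_ge[of n] assms(1) by simp
  have 2: "\<bar>w n\<bar> \<le> 1 * \<bar>w n - \<mu>\<bar>" for n
    using w_pos[of n] assms(1) by simp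
  show "z \<in> form_domain"
    by (rule bounded_solution_form_domain(1)[OF C_pos 1 assms(2,3) 2])
  show "res z = (\<lambda>n. \<mu> * z n)"
    using conv_eqI[OF assms(2)] by (auto simp: res_def algebra_simps)
qed

lemma df_form_domain: "df \<in> form_domain" and res_df: "res df = (\<lambda>n. 0)"
proof -
  \<comment> \<open>One power of decay of \<open>f\<close> makes \<open>df\<close> bounded; the
    bootstrap for the equation of \<open>df\<close> itself does the rest.\<close>
  obtain M where M: "\<And>n. \<bar>f n\<bar> * (1 + \<bar>real_of_int n\<bar>) ^ 1 \<le> M"
    using f_decay by blast
  have 1: "\<bar>df n\<bar> \<le> M" for n
  proof -
    have "\<bar>df n\<bar> \<le> \<bar>f n\<bar> * (1 + \<bar>real_of_int n\<bar>)"
      by (simp add: abs_mult algebra_simps)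
    thus ?thesis using M[of n] by simp
  qed
  have 2: "((\<lambda>k. a (n - k) * df k) has_sum ((w n - 0) * df n)) UNIV" for n
    using conv_df by simp
  show "df \<in> form_domain"
    by (rule negative_solution_form_domain(1)[OF order_refl 2 1])
  show "res df = (\<lambda>n. 0)"
    using negative_solution_form_domain(2)[OF order_refl 2 1] by simp
qed

lemma conv_f_eq: "conv f n = P * w n * f n"
  by (rule conv_eqI[OF conv_f])

lemma conv_df_eq: "conv df n = w n * df n"
  by (rule conv_eqI[OF conv_df])


text \<open>This is the Cauchy-Binet formula for the second compound of the convolution. Summing
  over all pairs instead of \<open>m1 < m2\<close> lets the double sum split into products of single
  sums; kernel and wedge both change sign under \<open>m1 \<leftrightarrow> m2\<close>, so each pair
  counts twice, whence the factor 2.\<close>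

lemma wedge_kernel_has_sum:
  assumes u: "u summable_on UNIV" and v: "v summable_on UNIV"
  shows "((\<lambda>(m1, m2). (a (n1 - m1) * a (n2 - m2) - a (n1 - m2) * a (n2 - m1)) * (u m1 * v m2 - v m1 * u m2))
            has_sum 2 * (conv u n1 * conv v n2 - conv v n1 * conv u n2)) UNIV"
proof -
  have row: "((\<lambda>(m1, m2). (a (n - m1) * x m1) * (a (n' - m2) * y m2)) has_sum conv x n * conv y n') UNIV"
    if "x summable_on UNIV" "y summable_on UNIV" for x y n n'
    using has_sum_product_UNIV[OF conv_has_sum[OF that(1), THEN has_sum_imp_summable]
        conv_has_sum[OF that(2), THEN has_sum_imp_summable], of n n']
    by (simp add: conv_def)
  have "((\<lambda>x. (case x of (m1, m2) \<Rightarrow> (a (n1 - m1) * u m1) * (a (n2 - m2) * v m2))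
        + (- 1) * (case x of (m1, m2) \<Rightarrow> (a (n1 - m1) * v m1) * (a (n2 - m2) * u m2))
        + ((- 1) * (case x of (m1, m2) \<Rightarrow> (a (n2 - m1) * u m1) * (a (n1 - m2) * v m2))
        + (case x of (m1, m2) \<Rightarrow> (a (n2 - m1) * v m1) * (a (n1 - m2) * u m2))))
      has_sum (conv u n1 * conv v n2 + (- 1) * (conv v n1 * conv u n2)
        + ((- 1) * (conv u n2 * conv v n1) + conv v n2 * conv u n1))) UNIV"
    by (intro has_sum_add has_sum_cmult_right row u v)
  also have "conv u n1 * conv v n2 + (- 1) * (conv v n1 * conv u n2)
        + ((- 1) * (conv u n2 * conv v n1) + conv v n2 * conv u n1)
      = 2 * (conv u n1 * conv v n2 - conv v n1 * conv u n2)"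
    by (simp add: algebra_simps)
  finally show ?thesis
    by (simp add: case_prod_unfold algebra_simps)
qed

text \<open>The exterior square of the convolution operator has a kernel of one sign, and
  \<open>f\<close> and \<open>df\<close> provide the positive eigenvector \<open>(n2 - n1) f(n1) f(n2)\<close> of it. The ground state
  inequality for this kernel, evaluated on the wedge of \<open>f\<close> and \<open>z\<close>, is the claim.\<close>

lemma wedge_inequality:
  assumes z: "z \<in> form_domain"
  shows "ip f (res z) * ip (\<lambda>n. w n * f n) z \<le> ip (\<lambda>n. w n * f n) f * ip z (res z)"
    and "ip f (res z) * ip (\<lambda>n. w n * f n) z = ip (\<lambda>n. w n * f n) f * ip z (res z)
           \<Longrightarrow> \<exists>s k. \<forall>n. z n = (s + k * n) * f n"
proof -
  define D where "D = (\<lambda>x y :: int \<times> int. a (fst x - fst y) * a (snd x - snd y) - a (fst x - snd y) * a (snd x - fst y))"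
  define h where "h = (\<lambda>x :: int \<times> int. f (fst x) * df (snd x) - df (fst x) * f (snd x))"
  \<comment> \<open>\<open>P\<close> and 1 are the eigenvalues of \<open>f\<close> and
    \<open>df\<close> relative to \<open>w\<close>, so their wedge has eigenvalue \<open>P\<close>;
    the 2 comes from counting ordered pairs.\<close>
  define V where "V = (\<lambda>x :: int \<times> int. 2 * P * w (fst x) * w (snd x))"
  \<comment> \<open>A difference quotient of \<open>z / f\<close>, constant off the diagonal exactly
    when \<open>z / f\<close> is affine. On the diagonal the division by zero gives 0, harmlessly,
    since \<open>h\<close> and \<open>G\<close> vanish there.\<close>
  define q where "q = (\<lambda>x :: int \<times> int. (z (snd x) / f (snd x) - z (fst x) / f (fst x)) / (snd x - fst x))"
  define G where "G = (\<lambda>x :: int \<times> int. f (fst x) * z (snd x) - z (fst x) * f (snd x))"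
  note fs = form_domainD[OF f_form_domain] and zs = form_domainD[OF z] and ds = form_domainD[OF df_form_domain]
  have f0: "f n \<noteq> 0" for n using f_pos[of n] by simp
  have h_eq: "h x = of_int (snd x - fst x) * (f (fst x) * f (snd x))" for x
    by (simp add: h_def algebra_simps)
  have G_eq: "q x * h x = G x" for x
  proof (cases "fst x = snd x")
    case True
    thus ?thesis by (simp add: h_eq G_def)
  next
    case False
    hence "real_of_int (snd x) - real_of_int (fst x) \<noteq> 0" by simp
    thus ?thesis using f0 by (simp add: h_eq G_def q_def field_simps)
  qed
  \<comment> \<open>Swapping the entries of \<open>x\<close> flips the signs of both
    \<open>D x y\<close> and \<open>h x\<close>, so the product is positive for all orderings once
    it is for increasing pairs.\<close>
  have sgn: "0 < D x y * h x * h y" if "fst x \<noteq> snd x" "fst y \<noteq> snd y" for x y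
  proof -
    have D: "0 < D x y" if "fst x < snd x \<and> fst y < snd y \<or> snd x < fst x \<and> snd y < fst y"
      using that a_minor[of "fst x" "snd x" "fst y" "snd y"] a_minor[of "snd x" "fst x" "snd y" "fst y"]
      by (auto simp: D_def mult_ac)
    have D': "D x y < 0" if "fst x < snd x \<and> snd y < fst y \<or> snd x < fst x \<and> fst y < snd y"
      using that a_minor[of "fst x" "snd x" "snd y" "fst y"] a_minor[of "snd x" "fst x" "fst y" "snd y"]
      by (auto simp: D_def mult_ac)
    have h1: "0 < h x" if "fst x < snd x" for x
      using that f_pos by (simp add: h_eq)
    have h2: "h x < 0" if "snd x < fst x" for x
      using that f_pos by (simp add: h_eq mult_neg_pos)
    consider "fst x < snd x" "fst y < snd y" | "fst x < snd x" "snd y < fst y"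
      | "snd x < fst x" "fst y < snd y" | "snd x < fst x" "snd y < fst y"
      using \<open>fst x \<noteq> snd x\<close> \<open>fst y \<noteq> snd y\<close> by linarith
    thus ?thesis
    proof cases
      case 1 thus ?thesis using D h1 by simp
    next
      case 2 thus ?thesis using D' h1[of x] h2[of y] by (simp add: mult_neg_neg mult_neg_pos)
    next
      case 3 thus ?thesis using D' h1[of y] h2[of x] by (simp add: mult_neg_neg)
    next
      case 4 thus ?thesis using D h2[of x] h2[of y] by (simp add: mult_neg_neg mult_pos_neg)
    qed
  qed
  have nonneg: "0 \<le> D x y * h x * h y" for x y
    using sgn[of x y] by (cases "fst x = snd x \<or> fst y = snd y") (auto simp: h_eq)
  have sym: "D x y = D y x" for x y
    by (simp add: D_def a_swap[of "fst x"] a_swap[of "snd x"])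
  have row: "((\<lambda>y. D x y * (u (fst y) * v (snd y) - v (fst y) * u (snd y)))
      has_sum 2 * (conv u (fst x) * conv v (snd x) - conv v (fst x) * conv u (snd x))) UNIV"
    if "u summable_on UNIV" "v summable_on UNIV" for u v x
    using wedge_kernel_has_sum[OF that, of "fst x" "snd x"] by (simp add: D_def case_prod_unfold)
  have hrow: "((\<lambda>y. D x y * h y) has_sum V x * h x) UNIV" for x
    using row[OF fs(1) ds(1), of x] by (simp add: h_def V_def conv_f_eq conv_df_eq algebra_simps)
  have Grow: "((\<lambda>y. D x y * G y) has_sum 2 * P * (w (fst x) * f (fst x) * conv z (snd x) - conv z (fst x) * (w (snd x) * f (snd x)))) UNIV" for x
    using row[OF fs(1) zs(1), of x] by (simp add: G_def conv_f_eq algebra_simps)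
  have prod: "((\<lambda>x. u (fst x) * v (snd x)) has_sum infsum u UNIV * infsum v UNIV) UNIV"
    if "u summable_on UNIV" "v summable_on UNIV" for u v :: "int \<Rightarrow> real"
    using has_sum_product_UNIV[OF that] by (simp add: case_prod_unfold)
  obtain F Z where F: "\<And>n. \<bar>f n\<bar> \<le> F" and Z: "\<And>n. \<bar>z n\<bar> \<le> Z"
    using summable_on_imp_bounded[OF fs(1)] summable_on_imp_bounded[OF zs(1)] by auto
  have Gb: "\<bar>G x\<bar> \<le> F * Z + Z * F" for x
  proof -
    have "\<bar>G x\<bar> \<le> \<bar>f (fst x)\<bar> * \<bar>z (snd x)\<bar> + \<bar>z (fst x)\<bar> * \<bar>f (snd x)\<bar>"
      unfolding G_def abs_mult[symmetric] by (rule abs_triangle_ineq4)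
    also have "\<dots> \<le> F * Z + Z * F"
      using F[of 0] Z[of 0] by (intro add_mono mult_mono F Z) auto
    finally show ?thesis .
  qed
  have wedge: "(\<lambda>x. G x * (2 * P * (w (fst x) * f (fst x) * v (snd x) - v (fst x) * (w (snd x) * f (snd x))))) summable_on UNIV"
    if v: "v summable_on UNIV" for v
  proof (rule summable_on_bounded_mult[OF _ Gb])
    have "(\<lambda>x. (2 * P) * ((w (fst x) * f (fst x)) * v (snd x)) + (- 2 * P) * (v (fst x) * (w (snd x) * f (snd x)))) summable_on UNIV"
      by (intro summable_on_add summable_on_cmult_right
           prod[THEN has_sum_imp_summable, of "\<lambda>n. w n * f n" v] prod[THEN has_sum_imp_summable, of v "\<lambda>n. w n * f n"] v fs)
    thus "(\<lambda>x. 2 * P * (w (fst x) * f (fst x) * v (snd x) - v (fst x) * (w (snd x) * f (snd x)))) summable_on UNIV"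
      by (simp add: algebra_simps)
  qed
  \<comment> \<open>One copy of \<open>G\<close> stays as the bounded factor; the other absorbs the
    weights and becomes the wedge of \<open>w f\<close> and \<open>w z\<close>, summable because
    \<open>w z\<close> is.\<close>
  have VG: "V x * (q x * h x)\<^sup>2
      = G x * (2 * P * (w (fst x) * f (fst x) * (w (snd x) * z (snd x)) - (w (fst x) * z (fst x)) * (w (snd x) * f (snd x))))" for x
    unfolding G_eq by (simp add: V_def G_def power2_eq_square algebra_simps)
  have S: "(\<lambda>x. V x * (q x * h x)\<^sup>2) summable_on UNIV"
    unfolding VG by (rule wedge[OF zs(2)])
  note GS = ground_state_inequality[OF sym nonneg hrow S]
  define I where "I = infsum (\<lambda>x. V x * (q x * h x)\<^sup>2) UNIV"
  define J where "J = infsum (\<lambda>(x, y). D x y * (q x * h x) * (q y * h y)) UNIV"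
  have J: "J = infsum (\<lambda>x. G x * (2 * P * (w (fst x) * f (fst x) * conv z (snd x) - conv z (fst x) * (w (snd x) * f (snd x))))) UNIV"
  proof -
    have s: "(\<lambda>(x, y). D x y * (q x * h x) * (q y * h y)) summable_on UNIV \<times> UNIV"
      using GS(1) by simp
    have "infsum (\<lambda>y. D x y * (q x * h x) * (q y * h y)) UNIV
        = G x * (2 * P * (w (fst x) * f (fst x) * conv z (snd x) - conv z (fst x) * (w (snd x) * f (snd x))))" for x
    proof -
      have "((\<lambda>y. G x * (D x y * G y)) has_sum G x * (2 * P * (w (fst x) * f (fst x) * conv z (snd x) - conv z (fst x) * (w (snd x) * f (snd x))))) UNIV"
        by (rule has_sum_cmult_right[OF Grow])
      thus ?thesis unfolding G_eq by (intro infsumI) (simp add: mult_ac)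
    qed
    thus ?thesis unfolding J_def using infsum_Sigma'_banach[OF s] by simp
  qed
  define r where "r = res z"
  \<comment> \<open>\<open>I\<close> and \<open>J\<close> are the same expression with
    \<open>w z\<close> and \<open>conv z\<close> in the free slot, the factor \<open>P\<close> in
    \<open>J\<close> coming from \<open>conv f = P w f\<close>. By linearity the difference contains
    only \<open>res z\<close>.\<close>
  have IJ: "((\<lambda>x. G x * (2 * P * (w (fst x) * f (fst x) * r (snd x) - r (fst x) * (w (snd x) * f (snd x))))) has_sum I - J) UNIV"
  proof -
    have "((\<lambda>x. G x * (2 * P * (w (fst x) * f (fst x) * (w (snd x) * z (snd x)) - (w (fst x) * z (fst x)) * (w (snd x) * f (snd x))))
        + (- 1) * (G x * (2 * P * (w (fst x) * f (fst x) * conv z (snd x) - conv z (fst x) * (w (snd x) * f (snd x)))))) has_sum I + (- 1) * J) UNIV"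
      unfolding J I_def VG
      by (intro has_sum_add has_sum_cmult_right has_sum_infsum wedge zs conv_summable)
    thus ?thesis by (simp add: r_def res_def algebra_simps)
  qed
  have rs: "r summable_on UNIV" unfolding r_def by (rule zs)
  define X where "X = ip (\<lambda>n. w n * f n) f * ip z r - ip f r * ip (\<lambda>n. w n * f n) z"
  \<comment> \<open>Binet-Cauchy: expanding both wedges gives four products of single sums, equal in
    pairs, so that \<open>2 P\<close> becomes \<open>4 P\<close> in front of
    \<open>X\<close>.\<close>
  have "((\<lambda>x. (2 * P) * ((w (fst x) * f (fst x) * f (fst x)) * (z (snd x) * r (snd x)))
        + (- 2 * P) * ((f (fst x) * r (fst x)) * (w (snd x) * f (snd x) * z (snd x)))
        + ((- 2 * P) * ((w (fst x) * f (fst x) * z (fst x)) * (f (snd x) * r (snd x)))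
        + (2 * P) * ((z (fst x) * r (fst x)) * (w (snd x) * f (snd x) * f (snd x)))))
      has_sum (2 * P) * (ip (\<lambda>n. w n * f n) f * ip z r) + (- 2 * P) * (ip f r * ip (\<lambda>n. w n * f n) z)
        + ((- 2 * P) * (ip (\<lambda>n. w n * f n) z * ip f r) + (2 * P) * (ip z r * ip (\<lambda>n. w n * f n) f))) UNIV"
    unfolding ip_def
    by (intro has_sum_add has_sum_cmult_right
       prod[of "\<lambda>n. w n * f n * f n" "\<lambda>n. z n * r n"] prod[of "\<lambda>n. f n * r n" "\<lambda>n. w n * f n * z n"]
       prod[of "\<lambda>n. w n * f n * z n" "\<lambda>n. f n * r n"] prod[of "\<lambda>n. z n * r n" "\<lambda>n. w n * f n * f n"]
       ip_has_sum[THEN has_sum_imp_summable] fs zs rs)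
  hence "((\<lambda>x. G x * (2 * P * (w (fst x) * f (fst x) * r (snd x) - r (fst x) * (w (snd x) * f (snd x))))) has_sum 4 * P * X) UNIV"
    by (simp add: G_def X_def algebra_simps)
  hence main: "I - J = 4 * P * X"
    using IJ has_sum_unique by blast
  have "J \<le> I" using GS(2) by (simp add: I_def J_def)
  hence "0 \<le> P * X" using main by linarith
  hence "0 \<le> X" using P_gt by (simp add: zero_le_mult_iff)
  thus "ip f (res z) * ip (\<lambda>n. w n * f n) z \<le> ip (\<lambda>n. w n * f n) f * ip z (res z)"
    by (simp add: X_def r_def)
  assume "ip f (res z) * ip (\<lambda>n. w n * f n) z = ip (\<lambda>n. w n * f n) f * ip z (res z)"
  hence "X = 0" by (simp add: X_def r_def)
  hence eq: "J = I" using main by simp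
  \<comment> \<open>Off the diagonal the squares in the ground state inequality carry strictly
    positive weights, so equality makes \<open>q\<close> constant there.\<close>
  have "q x = q y" if "fst x \<noteq> snd x" "fst y \<noteq> snd y" for x y
    using GS(3)[OF eq[unfolded I_def J_def], of x y] sgn[OF that] by auto
  hence q: "q (0, n) = q (0, 1)" if "n \<noteq> 0" for n
    using that by simp
  have "z n = (z 0 / f 0 + q (0, 1) * n) * f n" for n
  proof (cases "n = 0")
    case False
    have "z n / f n - z 0 / f 0 = q (0, 1) * n"
      using q[OF False] False by (simp add: q_def field_simps)
    thus ?thesis using f0[of n] by (simp add: field_simps)
  qed (use f0 in simp)
  thus "\<exists>s k. \<forall>n. z n = (s + k * n) * f n" by blast
qed


section \<open>Negative directions and kernel of the form\<close>

lemma ip_self_nonneg: "0 \<le> ip x x"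
  unfolding ip_def by (rule infsum_nonneg) simp

lemma ip_self_eq_0:
  assumes "x summable_on UNIV" "ip x x = 0"
  shows "x n = 0"
  using nonneg_has_sum_le_0D[OF ip_has_sum[OF assms(1,1)], of n] assms(2) by simp

lemma ip_wf_pos: "0 < ip (\<lambda>n. w n * f n) f"
proof -
  note fs = form_domainD[OF f_form_domain]
  have "0 < w 0 * f 0 * f 0" using w_pos f_pos by simp
  also have "\<dots> = (\<Sum>n\<in>{0}. w n * f n * f n)" by simp
  also have "\<dots> \<le> ip (\<lambda>n. w n * f n) f"
    by (rule finite_sum_le_has_sum[OF ip_has_sum[OF fs(2,1)]]) (use w_pos f_pos in \<open>auto intro: less_imp_le\<close>)
  finally show ?thesis .
qed

lemma res_f: "res f = (\<lambda>n. (1 - P) * (w n * f n))"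
  by (auto simp: res_def conv_f_eq algebra_simps)

lemma ip_scale:
  shows "ip x (\<lambda>n. s * y n) = s * ip x y" "ip (\<lambda>n. s * y n) x = s * ip y x"
proof -
  show "ip x (\<lambda>n. s * y n) = s * ip x y"
    unfolding ip_def using infsum_cmult_right'[of s "\<lambda>n. x n * y n" UNIV] by (simp add: mult_ac)
  thus "ip (\<lambda>n. s * y n) x = s * ip y x" by (simp add: ip_commute)
qed

lemma ip_f_res:
  assumes "z \<in> form_domain"
  shows "ip f (res z) = (1 - P) * ip (\<lambda>n. w n * f n) z"
  by (simp add: ip_res_commute[OF f_form_domain assms] res_f ip_scale)

text \<open>As \<open>w f\<close> is a multiple of \<open>res f\<close>, the condition is
  orthogonality to \<open>f\<close> with respect to the form itself; it kills the left side of the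
  wedge inequality.\<close>

lemma form_nonneg:
  assumes z: "z \<in> form_domain" and "ip (\<lambda>n. w n * f n) z = 0"
  shows "0 \<le> ip z (res z)"
  using wedge_inequality(1)[OF z] assms(2) ip_wf_pos by (simp add: zero_le_mult_iff)

text \<open>For \<open>res z = 0\<close> both sides of the wedge inequality vanish, so its equality
  case applies and \<open>z\<close> is a combination of \<open>f\<close> and \<open>df\<close>.
  Applying \<open>res\<close> annihilates \<open>df\<close> and leaves a multiple of
  \<open>(1 - P) w f\<close>, which removes \<open>f\<close> because \<open>P > 1\<close>.\<close>

lemma kernel_solution:
  assumes z: "z \<in> form_domain" and r: "res z = (\<lambda>n. 0)"
  shows "\<exists>k. z = (\<lambda>n. k * df n)"
proof -
  have "ip x (\<lambda>n. 0) = 0" for x by (simp add: ip_def)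
  then obtain s k where sk: "\<And>n. z n = (s + k * n) * f n"
    using wedge_inequality(2)[OF z] r by auto
  have "z = (\<lambda>n. s * f n + k * df n)"
    using sk by (auto simp: algebra_simps)
  hence "res z = (\<lambda>n. s * res f n + k * res df n)"
    by (simp add: res_lincomb[OF f_form_domain df_form_domain])
  hence "s * ((1 - P) * (w 0 * f 0)) = 0"
    using r by (auto simp: res_f res_df fun_eq_iff)
  hence "s = 0" using w_pos[of 0] f_pos[of 0] P_gt by simp
  thus ?thesis using sk by (auto simp: fun_eq_iff)
qed

lemma negative_eigen_not_orthogonal:
  assumes y: "y \<in> form_domain" and ry: "res y = (\<lambda>n. \<mu> * y n)" and "\<mu> < 0" "y m \<noteq> 0"
  shows "ip (\<lambda>n. w n * f n) y \<noteq> 0"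
proof
  assume "ip (\<lambda>n. w n * f n) y = 0"
  hence "0 \<le> \<mu> * ip y y"
    using form_nonneg[OF y] by (simp add: ry ip_scale)
  hence "ip y y = 0"
    using \<open>\<mu> < 0\<close> ip_self_nonneg[of y] by (simp add: zero_le_mult_iff)
  thus False using ip_self_eq_0[OF form_domainD(1)[OF y]] \<open>y m \<noteq> 0\<close> by blast
qed

lemma negative_eigen_unique:
  assumes y: "y \<in> form_domain" and ry: "res y = (\<lambda>n. \<mu> * y n)" and \<mu>: "\<mu> < 0" "y m \<noteq> 0"
    and z: "z \<in> form_domain" and rz: "res z = (\<lambda>n. \<nu> * z n)" and \<nu>: "\<nu> < 0"
  shows "\<exists>k. z = (\<lambda>n. k * y n)" and "z m' \<noteq> 0 \<Longrightarrow> \<nu> = \<mu>"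
proof -
  define s t where "s = ip (\<lambda>n. w n * f n) z" and "t = ip (\<lambda>n. w n * f n) y"
  have t: "t \<noteq> 0" using negative_eigen_not_orthogonal[OF y ry \<mu>] by (simp add: t_def)
  define x where "x = (\<lambda>n. s * y n + (- t) * z n)"
  note ys = form_domainD[OF y] and zs = form_domainD[OF z] and fs = form_domainD[OF f_form_domain]
  have x: "x \<in> form_domain" unfolding x_def by (rule form_domain_lincomb[OF y z])
  note xs = form_domainD[OF x]
  have "ip (\<lambda>n. w n * f n) x = 0"
    unfolding x_def ip_lincomb(1)[OF fs(2) ys(1) zs(1)] by (simp add: s_def t_def)
  hence Q: "0 \<le> ip x (res x)" by (rule form_nonneg[OF x])
  have rx: "res x = (\<lambda>n. s * (\<mu> * y n) + (- t) * (\<nu> * z n))"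
    unfolding x_def res_lincomb[OF y z] by (simp add: ry rz)
  have yz: "\<nu> * ip y z = \<mu> * ip y z"
    using ip_res_commute[OF y z] by (simp add: ry rz ip_scale)
  have \<mu>\<nu>: "\<nu> = \<mu>" if nz: "z m' \<noteq> 0" for m'
  proof (rule ccontr)
    assume "\<nu> \<noteq> \<mu>"
    hence 0: "ip y z = 0" "ip z y = 0" using yz by (auto simp: ip_commute)
    have s: "(\<lambda>n. \<mu> * y n) summable_on UNIV" "(\<lambda>n. \<nu> * z n) summable_on UNIV"
      by (intro summable_on_cmult_right ys zs)+
    have "ip x (res x) = s * ip x (\<lambda>n. \<mu> * y n) + (- t) * ip x (\<lambda>n. \<nu> * z n)"
      unfolding rx by (rule ip_lincomb(1)[OF xs(1) s])
    also have "\<dots> = s * \<mu> * ip x y + (- t) * \<nu> * ip x z" by (simp add: ip_scale)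
    also have "ip x y = s * ip y y"
      unfolding x_def ip_lincomb(2)[OF ys(1) ys(1) zs(1)] by (simp add: 0)
    also have "ip x z = - t * ip z z"
      unfolding x_def ip_lincomb(2)[OF zs(1) ys(1) zs(1)] by (simp add: 0)
    also have "s * \<mu> * (s * ip y y) + (- t) * \<nu> * (- t * ip z z) = \<mu> * (s\<^sup>2 * ip y y) + \<nu> * (t\<^sup>2 * ip z z)"
      by (simp add: power2_eq_square)
    finally have "0 \<le> \<mu> * (s\<^sup>2 * ip y y) + \<nu> * (t\<^sup>2 * ip z z)" using Q by simp
    moreover have "\<mu> * (s\<^sup>2 * ip y y) \<le> 0"
      using \<mu> ip_self_nonneg[of y] by (simp add: mult_nonpos_nonneg)
    ultimately have "0 \<le> \<nu> * (t\<^sup>2 * ip z z)" by linarith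
    hence "t\<^sup>2 * ip z z \<le> 0" using \<nu> by (simp add: zero_le_mult_iff)
    hence "ip z z = 0" using t ip_self_nonneg[of z] by (simp add: mult_le_0_iff)
    thus False using ip_self_eq_0[OF zs(1)] nz by blast
  qed
  show "z m' \<noteq> 0 \<Longrightarrow> \<nu> = \<mu>" by (rule \<mu>\<nu>)
  show "\<exists>k. z = (\<lambda>n. k * y n)"
  proof (cases "\<exists>m'. z m' \<noteq> 0")
    case False
    thus ?thesis by (intro exI[of _ 0]) auto
  next
    case True
    hence "\<nu> = \<mu>" using \<mu>\<nu> by blast
    hence "res x = (\<lambda>n. \<mu> * x n)" unfolding rx by (simp add: x_def algebra_simps)
    hence "x n = 0" for n
      using negative_eigen_not_orthogonal[OF x _ \<mu>(1), of n] \<open>ip (\<lambda>n. w n * f n) x = 0\<close> by blast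
    hence "z n = s / t * y n" for n
      using t by (simp add: x_def field_simps)
    thus ?thesis by blast
  qed
qed

text \<open>A Schur test: the ground state inequality with \<open>h = 1\<close>, whose rows all sum
  to \<open>infsum a UNIV\<close>.\<close>

lemma ip_conv_bound:
  assumes z: "z summable_on UNIV"
  shows "ip z (conv z) \<le> infsum a UNIV * ip z z"
proof -
  have "ip z (conv z) = infsum (\<lambda>(n, k). z n * (a (n - k) * z k)) (UNIV \<times> UNIV)"
    by (rule ip_conv_double_sum[OF z z])
  also have "\<dots> = infsum (\<lambda>(n, k). a (n - k) * (z n * 1) * (z k * 1)) UNIV"
    by (simp add: mult_ac)
  also have "\<dots> \<le> infsum (\<lambda>n. infsum a UNIV * (z n * 1)\<^sup>2) UNIV"
  proof (rule ground_state_inequality(2))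
    show "((\<lambda>k. a (n - k) * 1) has_sum infsum a UNIV * 1) UNIV" for n
      using a_row by simp
    show "(\<lambda>n. infsum a UNIV * (z n * 1)\<^sup>2) summable_on UNIV"
      using ip_has_sum[OF z z] by (intro summable_on_cmult_right) (auto simp: power2_eq_square dest: has_sum_imp_summable)
  qed (use a_pos a_swap in \<open>auto intro: less_imp_le\<close>)
  also have "\<dots> = infsum a UNIV * ip z z"
    by (simp add: ip_def power2_eq_square infsum_cmult_right')
  finally show ?thesis .
qed

end

section \<open>Existence of a negative eigenvalue\<close>

lemma nonneg_quadratic_discriminant:
  fixes A g B :: real
  assumes "\<And>t. 0 \<le> A + 2 * t * g + t\<^sup>2 * B" "0 < B"
  shows "g\<^sup>2 \<le> A * B"
proof -
  have "0 \<le> A + 2 * (- g / B) * g + (- g / B)\<^sup>2 * B" by (rule assms)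
  also have "\<dots> = A - g\<^sup>2 / B"
    using assms(2) by (simp add: power2_eq_square field_simps)
  finally show ?thesis using assms(2) by (simp add: field_simps)
qed

context wave_sequences
begin

definition unit_seq :: "int \<Rightarrow> int \<Rightarrow> real" where
  "unit_seq n k = (if k = n then 1 else 0)"

lemma unit_seq_has_sum: "((\<lambda>k. x k * unit_seq n k) has_sum x n) UNIV"
  by (rule has_sum_finite_neutralI[where B="{n}"]) (auto simp: unit_seq_def)

lemma unit_seq_form_domain: "unit_seq n \<in> form_domain"
  using unit_seq_has_sum[of "\<lambda>_. 1" n] unit_seq_has_sum[of w n]
  by (auto simp: form_domain_def dest: has_sum_imp_summable)

lemma ip_unit_seq: "ip x (unit_seq n) = x n"
  unfolding ip_def by (rule infsumI[OF unit_seq_has_sum])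

text \<open>Read as a bound on the \<open>w\<close>-energy: it bounds the Rayleigh quotient from
  below and later confines the mass of a minimising sequence to finitely many frequencies.\<close>

lemma rayleigh_lower_bound:
  assumes z: "z \<in> form_domain"
  shows "ip z (\<lambda>n. w n * z n) \<le> ip z (res z) + infsum a UNIV * ip z z"
proof -
  note zs = form_domainD[OF z]
  have "ip z (res z) = ip z (\<lambda>n. w n * z n) - ip z (conv z)"
    using ip_lincomb(1)[OF zs(1,2) conv_summable[OF zs(1)], of 1 "-1"]
    by (simp add: res_def[abs_def])
  thus ?thesis using ip_conv_bound[OF zs(1)] by simp
qed

text \<open>The direct method with coordinatewise compactness: near-minimisers nearly satisfy the
  Euler-Lagrange equation in each coordinate, so the equation passes to a coordinatewise limit, and
  what remains to be shown of the limit is that it does not vanish.\<close>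

lemma negative_eigen_exists:
  "\<exists>\<mu> z m Z. \<mu> < 0 \<and> (\<forall>n. \<bar>z n\<bar> \<le> Z) \<and> z m \<noteq> 0 \<and>
     (\<forall>n. ((\<lambda>k. a (n - k) * z k) has_sum ((w n - \<mu>) * z n)) UNIV)"
proof -
  define S where "S = {ip z (res z) | z. z \<in> form_domain \<and> ip z z = 1}"
  define A where "A = infsum a UNIV"
  define \<mu> where "\<mu> = Inf S"
  have low: "- A * ip z z \<le> ip z (res z)" if z: "z \<in> form_domain" for z
  proof -
    have "0 \<le> ip z (\<lambda>n. w n * z n)"
      unfolding ip_def using w_pos
      by (intro infsum_nonneg) (simp add: mult.left_commute[of "z _"] less_imp_le)
    thus ?thesis using rayleigh_lower_bound[OF z] by (simp add: A_def)
  qed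
  have bdd: "bdd_below S"
    by (rule bdd_belowI[of _ "- A"]) (use low in \<open>force simp: S_def\<close>)
  have \<mu>_le: "\<mu> * ip z z \<le> ip z (res z)" if z: "z \<in> form_domain" for z
  proof (cases "ip z z = 0")
    case True
    hence "z = (\<lambda>n. 0)" using ip_self_eq_0[OF form_domainD(1)[OF z]] by blast
    thus ?thesis by (simp add: ip_def)
  next
    case False
    define s where "s = 1 / sqrt (ip z z)"
    have p: "0 < ip z z" using False ip_self_nonneg[of z] by simp
    have s2: "s * s * ip z z = 1" using p by (simp add: s_def)
    define y where "y = (\<lambda>n. s * z n)"
    have y: "y \<in> form_domain"
      using form_domain_lincomb[OF z z, of s 0] by (simp add: y_def)
    have ry: "res y = (\<lambda>n. s * res z n)"
      using res_lincomb[OF z z, of s 0] by (simp add: y_def)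
    have "ip y y = 1" using s2 by (simp add: y_def ip_scale)
    hence "\<mu> \<le> ip y (res y)"
      unfolding \<mu>_def using y by (intro cInf_lower bdd) (auto simp: S_def)
    hence "\<mu> * ip z z \<le> (s * s * ip z (res z)) * ip z z"
      using p by (simp add: y_def ry[unfolded y_def] ip_scale mult_ac)
    also have "\<dots> = ip z (res z)" using s2 by (metis mult.assoc mult.commute mult_1)
    finally show ?thesis .
  qed
  \<comment> \<open>The trial sequence is \<open>f\<close>, at which the form equals
    \<open>(1 - P)\<close> times a positive number.\<close>
  have "\<mu> < 0"
  proof -
    have "0 < ip f f"
      using ip_self_nonneg[of f] ip_self_eq_0[OF form_domainD(1)[OF f_form_domain], of 0] f_pos[of 0] by fastforce
    moreover have "\<mu> * ip f f \<le> (1 - P) * ip (\<lambda>n. w n * f n) f"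
      using \<mu>_le[OF f_form_domain] ip_f_res[OF f_form_domain] by simp
    moreover have "(1 - P) * ip (\<lambda>n. w n * f n) f < 0"
      using P_gt ip_wf_pos by (simp add: mult_neg_pos)
    ultimately show ?thesis by (meson le_less_trans mult_less_0_iff not_less_iff_gr_or_eq)
  qed
  have "S \<noteq> {}"
  proof -
    have "ip (unit_seq 0) (unit_seq 0) = 1" by (simp add: ip_unit_seq) (simp add: unit_seq_def)
    thus ?thesis using unit_seq_form_domain by (auto simp: S_def)
  qed
  have "\<exists>u. u \<in> form_domain \<and> ip u u = 1 \<and> ip u (res u) < \<mu> + 1 / real (Suc j)" for j
  proof -
    have "Inf S < \<mu> + 1 / real (Suc j)" by (simp add: \<mu>_def)
    thus ?thesis using cInf_lessD[OF \<open>S \<noteq> {}\<close>] by (fastforce simp: S_def)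
  qed
  then obtain u where u: "\<And>j. u j \<in> form_domain" "\<And>j. ip (u j) (u j) = 1"
      "\<And>j. ip (u j) (res (u j)) < \<mu> + 1 / real (Suc j)"
    by metis
  note us = form_domainD[OF u(1)]
  have u_le1: "\<bar>u j n\<bar> \<le> 1" for j n
  proof -
    have "(\<Sum>n\<in>{n}. u j n * u j n) \<le> ip (u j) (u j)"
      by (rule finite_sum_le_has_sum[OF ip_has_sum[OF us(1,1)]]) auto
    hence "(u j n)\<^sup>2 \<le> 1" by (simp add: u power2_eq_square)
    thus ?thesis by (simp add: abs_square_le_1)
  qed
  have g: "(\<lambda>j. res (u j) n - \<mu> * u j n) \<longlonglongrightarrow> 0" for n
  proof -
    \<comment> \<open>Dominates the coefficient of \<open>t\<^sup>2\<close> when \<open>u j\<close>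
      is perturbed by \<open>t * unit_seq n\<close>; the added 1 keeps it positive for the
      discriminant bound, which estimates the squared residual by \<open>B\<close> times the gap to
      the infimum.\<close>
    define B where "B = \<bar>res (unit_seq n) n - \<mu>\<bar> + 1"
    have sq: "(res (u j) n - \<mu> * u j n)\<^sup>2 \<le> 1 / real (Suc j) * B" for j
    proof -
      let ?e = "unit_seq n"
      note es = form_domainD[OF unit_seq_form_domain, of n]
      have "(res (u j) n - \<mu> * u j n)\<^sup>2 \<le> (ip (u j) (res (u j)) - \<mu>) * B"
      proof (rule nonneg_quadratic_discriminant)
        show "0 < B" by (simp add: B_def)
        fix t :: real
        define y where "y = (\<lambda>k. 1 * u j k + t * ?e k)"
        have y: "y \<in> form_domain" unfolding y_def by (rule form_domain_lincomb[OF u(1) unit_seq_form_domain])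
        have ry: "res y = (\<lambda>k. 1 * res (u j) k + t * res ?e k)"
          unfolding y_def by (rule res_lincomb[OF u(1) unit_seq_form_domain])
        have "ip y (res y) = ip y (res (u j)) + t * ip y (res ?e)"
          unfolding ry using ip_lincomb(1)[OF form_domainD(1)[OF y] us(3) es(3), of 1] by simp
        also have "ip y (res (u j)) = ip (u j) (res (u j)) + t * res (u j) n"
          unfolding y_def using ip_lincomb(2)[OF us(3) us(1) es(1), of 1] by (simp add: ip_unit_seq ip_commute[of ?e])
        also have "ip y (res ?e) = ip (u j) (res ?e) + t * ip ?e (res ?e)"
          unfolding y_def using ip_lincomb(2)[OF es(3) us(1) es(1), of 1] by simp
        also have "ip (u j) (res ?e) = res (u j) n"
          unfolding ip_res_commute[OF u(1) unit_seq_form_domain] by (rule ip_unit_seq)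
        also have "ip ?e (res ?e) = res ?e n" by (simp add: ip_unit_seq ip_commute[of ?e])
        finally have 1: "ip y (res y) = ip (u j) (res (u j)) + t * res (u j) n + t * (res (u j) n + t * res ?e n)" .
        have "ip y y = ip y (u j) + t * ip y ?e"
          unfolding y_def[THEN eq_reflection] using ip_lincomb(1)[OF form_domainD(1)[OF y] us(1) es(1), of 1] by (simp add: y_def)
        also have "ip y (u j) = 1 + t * u j n"
          unfolding y_def using ip_lincomb(2)[OF us(1) us(1) es(1), of 1] by (simp add: ip_unit_seq ip_commute[of ?e] u)
        also have "ip y ?e = u j n + t" by (simp add: ip_unit_seq y_def unit_seq_def)
        finally have 2: "ip y y = 1 + t * u j n + t * (u j n + t)" .
        have "0 \<le> ip y (res y) - \<mu> * ip y y" using \<mu>_le[OF y] by simp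
        also have "\<dots> = (ip (u j) (res (u j)) - \<mu>) + 2 * t * (res (u j) n - \<mu> * u j n) + t\<^sup>2 * (res ?e n - \<mu>)"
          unfolding 1 2 by (simp add: power2_eq_square algebra_simps)
        also have "\<dots> \<le> (ip (u j) (res (u j)) - \<mu>) + 2 * t * (res (u j) n - \<mu> * u j n) + t\<^sup>2 * B"
          by (intro add_left_mono mult_left_mono) (auto simp: B_def)
        finally show "0 \<le> (ip (u j) (res (u j)) - \<mu>) + 2 * t * (res (u j) n - \<mu> * u j n) + t\<^sup>2 * B" .
      qed
      also have "\<dots> \<le> 1 / real (Suc j) * B"
        using u(3)[of j] by (intro mult_right_mono) (auto simp: B_def)
      finally show ?thesis .
    qed
    define e where "e = (\<lambda>j. 1 / real (Suc j) * B)"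
    define d where "d = (\<lambda>j. res (u j) n - \<mu> * u j n)"
    have e: "e \<longlonglongrightarrow> 0"
      unfolding e_def by (rule tendsto_mult_left_zero[OF LIMSEQ_Suc[OF lim_1_over_n]])
    have d: "\<forall>\<^sub>F j in sequentially. (d j)\<^sup>2 \<le> e j"
      unfolding d_def e_def by (rule always_eventually[OF allI[OF sq]])
    have "(\<lambda>j. (d j)\<^sup>2) \<longlonglongrightarrow> 0"
      by (rule tendsto_sandwich[OF _ d tendsto_const e]) simp
    hence "d \<longlonglongrightarrow> 0" by simp
    thus ?thesis by (simp only: d_def)
  qed
  obtain r :: "nat \<Rightarrow> nat" where r: "strict_mono r"
      "\<And>n. n \<in> UNIV \<Longrightarrow> \<exists>l. (\<lambda>j. u (r j) n) \<longlonglongrightarrow> l"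
    by (rule function_convergent_subsequence[of "UNIV :: int set" u 1]) (use u_le1 in auto)
  then obtain z where z: "\<And>n. (\<lambda>j. u (r j) n) \<longlonglongrightarrow> z n"
    by (metis UNIV_I)
  have z_le1: "\<bar>z n\<bar> \<le> 1" for n
    by (rule LIMSEQ_le_const2[OF tendsto_rabs[OF z]]) (use u_le1 in auto)
  have az: "((\<lambda>k. a (n - k) * z k) has_sum ((w n - \<mu>) * z n)) UNIV" for n
  proof -
    have as: "(\<lambda>k. a (n - k)) summable_on UNIV"
      using a_row has_sum_imp_summable by blast
    have s: "(\<lambda>k. a (n - k) * z k) summable_on UNIV"
      using summable_on_bounded_mult[OF as, of z 1] z_le1 by (simp add: mult.commute)
    \<comment> \<open>Since \<open>\<bar>u (r j) k\<bar> \<le> 1\<close>, the row of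
      \<open>a\<close> is a majorant uniform in \<open>j\<close>, which permits exchanging the limit
      in \<open>j\<close> with the sum.\<close>
    have ul: "uniform_limit UNIV (\<lambda>X j. \<Sum>k\<in>X. a (n - k) * u (r j) k) (\<lambda>j. conv (u (r j)) n) (finite_subsets_at_top UNIV)"
      unfolding conv_def
    proof (rule Weierstrass_m_test_general[OF _ as])
      show "norm (a (n - k) * u (r j) k) \<le> a (n - k)" for k j
        using u_le1[of "r j" k] a_pos[of "n - k"] by (simp add: abs_mult mult_left_le)
    qed
    have c: "(\<lambda>j. conv (u (r j)) n) \<longlonglongrightarrow> conv z n"
    proof (rule swap_uniform_limit'[OF _ _ ul])
      show "\<forall>\<^sub>F X in finite_subsets_at_top UNIV. (\<lambda>j. \<Sum>k\<in>X. a (n - k) * u (r j) k) \<longlonglongrightarrow> (\<Sum>k\<in>X. a (n - k) * z k)"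
        by (intro always_eventually allI tendsto_intros z)
      show "((\<lambda>X. \<Sum>k\<in>X. a (n - k) * z k) \<longlongrightarrow> conv z n) (finite_subsets_at_top UNIV)"
        using s unfolding conv_def has_sum_def[symmetric] by simp
    qed auto
    have "(\<lambda>j. res (u (r j)) n - \<mu> * u (r j) n) \<longlonglongrightarrow> w n * z n - conv z n - \<mu> * z n"
      unfolding res_def by (intro tendsto_intros z c)
    moreover have "(\<lambda>j. res (u (r j)) n - \<mu> * u (r j) n) \<longlonglongrightarrow> 0"
      using LIMSEQ_subseq_LIMSEQ[OF g r(1), of n] by (simp add: o_def)
    ultimately have "w n * z n - conv z n - \<mu> * z n = 0"
      by (rule LIMSEQ_unique)
    hence "conv z n = (w n - \<mu>) * z n" by (simp add: algebra_simps)
    thus ?thesis using s unfolding conv_def by (metis has_sum_infsum)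
  qed
  have "\<exists>m. z m \<noteq> 0"
  proof -
    \<comment> \<open>\<open>E\<close> bounds the \<open>w\<close>-energy of every
      \<open>u j\<close>, the gap \<open>1 / Suc j\<close> being at most 1. With
      \<open>C (1 + N) \<ge> 2 E\<close> at most half of the unit mass lies outside
      \<open>{-N..N}\<close>, so half of it survives in a finite sum and hence in the limit.\<close>
    define E where "E = \<mu> + 1 + A"
    obtain N :: nat where N: "2 * E / C \<le> real N" using real_arch_simple by blast
    define F where "F = {- int N..int N}"
    have tail: "1 / 2 \<le> (\<Sum>n\<in>F. (u j n)\<^sup>2)" for j
    proof -
      define V where "V = ip (u j) (\<lambda>n. w n * u j n)"
      have "V \<le> ip (u j) (res (u j)) + A * 1"
        using rayleigh_lower_bound[OF u(1)] u(2) by (metis A_def V_def)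
      also have "ip (u j) (res (u j)) \<le> \<mu> + 1"
        using u(3)[of j] by (smt (verit) divide_le_eq_1_pos of_nat_0_less_iff of_nat_Suc of_nat_0_le_iff zero_less_Suc)
      finally have VE: "V \<le> E" by (simp add: E_def)
      have c: "0 < C * (1 + real N)" using C_pos by simp
      define \<kappa> where "\<kappa> = 1 / (C * (1 + real N))"
      have \<kappa>: "0 < \<kappa>" "\<kappa> * (C * (1 + real N)) = 1" using c by (auto simp: \<kappa>_def)
      have 1: "((\<lambda>n. u j n * u j n) has_sum 1) UNIV"
        using ip_has_sum[OF us(1) us(1), of j j] by (simp add: u)
      have 2: "((\<lambda>n. if n \<in> F then (u j n)\<^sup>2 else 0) has_sum (\<Sum>n\<in>F. (u j n)\<^sup>2)) UNIV"
        by (rule has_sum_finite_neutralI[where B=F]) (auto simp: F_def)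
      have 3: "((\<lambda>n. \<kappa> * (u j n * (w n * u j n))) has_sum \<kappa> * V) UNIV"
        unfolding V_def by (intro has_sum_cmult_right ip_has_sum us)
      have "1 \<le> (\<Sum>n\<in>F. (u j n)\<^sup>2) + \<kappa> * V"
      proof (rule has_sum_mono[OF 1 has_sum_add[OF 2 3]])
        fix n
        show "u j n * u j n \<le> (if n \<in> F then (u j n)\<^sup>2 else 0) + \<kappa> * (u j n * (w n * u j n))"
        proof (cases "n \<in> F")
          case True
          have "0 \<le> \<kappa> * (w n * (u j n * u j n))"
            using \<kappa> w_pos[of n] by simp
          thus ?thesis using True by (simp add: power2_eq_square mult.left_commute[of "u j n" "w n"])
        next
          case False
          hence "real N \<le> \<bar>real_of_int n\<bar>" by (auto simp: F_def)
          hence "C * (1 + real N) \<le> w n"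
            using w_ge[of n] C_pos by (meson add_left_mono mult_left_mono less_imp_le order_trans)
          hence "C * (1 + real N) * (u j n * u j n) \<le> w n * (u j n * u j n)"
            by (intro mult_right_mono) auto
          hence "\<kappa> * (C * (1 + real N) * (u j n * u j n))
              \<le> \<kappa> * (w n * (u j n * u j n))"
            using \<kappa> by (intro mult_left_mono) auto
          also have "\<kappa> * (C * (1 + real N) * (u j n * u j n)) = u j n * u j n"
            using \<kappa>(2) by (metis mult.assoc mult_1)
          finally show ?thesis using False by (simp add: mult.left_commute[of "u j n" "w n"])
        qed
      qed
      moreover have "\<kappa> * V \<le> 1 / 2"
      proof -
        have "2 * E \<le> C * (1 + real N)"
          using N C_pos by (simp add: field_simps)
        hence "V \<le> C * (1 + real N) * (1 / 2)" using VE by linarith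
        hence "\<kappa> * V \<le> \<kappa> * (C * (1 + real N) * (1 / 2))"
          using \<kappa> by (intro mult_left_mono) auto
        thus ?thesis using \<kappa>(2) by (metis mult.assoc mult_1)
      qed
      ultimately show ?thesis by linarith
    qed
    have "(\<lambda>j. \<Sum>n\<in>F. (u (r j) n)\<^sup>2) \<longlonglongrightarrow> (\<Sum>n\<in>F. (z n)\<^sup>2)"
      by (intro tendsto_intros z)
    hence "1 / 2 \<le> (\<Sum>n\<in>F. (z n)\<^sup>2)"
      by (rule LIMSEQ_le_const) (use tail in auto)
    thus ?thesis by (metis (no_types, lifting) not_one_le_zero half_gt_zero_iff linorder_not_le sum.neutral zero_eq_power2 zero_less_one)
  qed
  thus ?thesis using \<open>\<mu> < 0\<close> z_le1 az by blast
qed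

end

section \<open>Fourier coefficients of integrable functions\<close>

abbreviation per_integrable :: "real \<Rightarrow> (real \<Rightarrow> complex) \<Rightarrow> bool" where
  "per_integrable L f \<equiv> set_integrable lebesgue {-L..L} f"

definition character :: "real \<Rightarrow> int \<Rightarrow> real \<Rightarrow> complex" where
  "character L n x = cis (of_int n * pi * x / L)"

lemma character_mult: "character L m x * character L n x = character L (m + n) x"
  by (simp add: character_def cis_mult add_divide_distrib distrib_right)

lemma character_0 [simp]: "character L 0 x = 1"
  by (simp add: character_def)

lemma norm_character [simp]: "norm (character L n x) = 1"
  by (simp add: character_def)

lemma continuous_on_character [continuous_intros]: "continuous_on S (character L n)"
proof -
  have "continuous_on S (\<lambda>x. cis ((of_int n * pi / L) * x))"
    by (intro continuous_intros)
  thus ?thesis by (simp add: character_def[abs_def] mult.commute)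
qed

lemma character_periodic:
  assumes "L \<noteq> 0"
  shows "character L n (x + 2 * L) = character L n x"
proof -
  have "of_int n * pi * (x + 2 * L) / L = of_int n * pi * x / L + 2 * pi * of_int n"
    using assms by (simp add: field_simps)
  thus ?thesis by (simp add: character_def cis_mult[symmetric] cis_multiple_2pi)
qed

lemma fourier_coeff_character:
  "fourier_coeff L f n = (LINT x:{-L..L}|lebesgue. f x * character L (- n) x) / of_real (2 * L)"
  by (simp add: fourier_coeff_def character_def cis_conv_exp)

lemma per_integrable_mult_continuous:
  assumes f: "per_integrable L f" and g: "continuous_on UNIV g"
  shows "per_integrable L (\<lambda>x. f x * g x)"
proof -
  have "(\<lambda>x. g x * f x) absolutely_integrable_on {-L..L}"
  proof (rule absolutely_integrable_bounded_measurable_product[OF bilinear_times _ _ _ f])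
    show "g \<in> borel_measurable (lebesgue_on {- L..L})"
      by (rule continuous_imp_measurable_on_sets_lebesgue[OF continuous_on_subset[OF g]]) auto
    show "bounded (g ` {- L..L})"
      by (intro compact_imp_bounded compact_continuous_image continuous_on_subset[OF g]) auto
  qed auto
  thus ?thesis by (simp add: mult.commute)
qed

lemma per_integrable_continuous:
  assumes "continuous_on UNIV g"
  shows "per_integrable L g"
  by (rule absolutely_integrable_continuous_real[OF continuous_on_subset[OF assms]]) auto

lemma fourier_coeff_lincomb:
  assumes "per_integrable L f" "per_integrable L g"
  shows "fourier_coeff L (\<lambda>x. s * f x + t * g x) n = s * fourier_coeff L f n + t * fourier_coeff L g n"
proof -
  have "per_integrable L (\<lambda>x. f x * character L (- n) x)" "per_integrable L (\<lambda>x. g x * character L (- n) x)"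
    by (intro per_integrable_mult_continuous assms continuous_on_character)+
  hence "(LINT x:{-L..L}|lebesgue. s * (f x * character L (- n) x) + t * (g x * character L (- n) x))
     = s * (LINT x:{-L..L}|lebesgue. f x * character L (- n) x) + t * (LINT x:{-L..L}|lebesgue. g x * character L (- n) x)"
    by simp
  thus ?thesis
    by (simp add: fourier_coeff_character add_divide_distrib algebra_simps)
qed

lemma fourier_coeff_shift:
  "fourier_coeff L (\<lambda>x. f x * character L k x) n = fourier_coeff L f (n - k)"
  by (simp add: fourier_coeff_character mult.assoc character_mult)

lemma norm_fourier_coeff_le:
  assumes "per_integrable L f" "0 < L"
  shows "norm (fourier_coeff L f n) \<le> (LINT x:{-L..L}|lebesgue. norm (f x)) / (2 * L)"
proof -
  have "norm (LINT x:{-L..L}|lebesgue. f x * character L (- n) x) \<le> (LINT x:{-L..L}|lebesgue. norm (f x * character L (- n) x))"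
    by (intro set_integral_norm_bound per_integrable_mult_continuous assms continuous_on_character)
  thus ?thesis
    using assms(2) by (simp add: fourier_coeff_character norm_mult norm_divide divide_right_mono)
qed

lemma set_integral_mult_bound:
  assumes f: "per_integrable L f" and g: "continuous_on UNIV g"
    and e: "\<And>x. norm (g x) \<le> e"
  shows "norm (LINT x:{-L..L}|lebesgue. f x * g x) \<le> e * (LINT x:{-L..L}|lebesgue. norm (f x))"
proof -
  have fg: "per_integrable L (\<lambda>x. f x * g x)"
    by (rule per_integrable_mult_continuous[OF f g])
  have "norm (LINT x:{-L..L}|lebesgue. f x * g x) \<le> (LINT x:{-L..L}|lebesgue. norm (f x * g x))"
    by (rule set_integral_norm_bound[OF fg])
  also have "\<dots> \<le> (LINT x:{-L..L}|lebesgue. e * norm (f x))"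
  proof (rule set_integral_mono)
    show "set_integrable lebesgue {-L..L} (\<lambda>x. norm (f x * g x))"
      by (rule set_integrable_norm[OF fg])
    show "set_integrable lebesgue {-L..L} (\<lambda>x. e * norm (f x))"
      using set_integrable_norm[OF f] by simp
    show "norm (f x * g x) \<le> e * norm (f x)" for x
      using e[of x] by (simp add: norm_mult mult.commute[of "norm (f x)"] mult_right_mono)
  qed
  finally show ?thesis by simp
qed

subsection \<open>Uniqueness\<close>

text \<open>Integrability suffices as the standing assumption: uniqueness is applied to values of
  the linearised operator, for which integrability over a period is what is established.\<close>

definition null_coeffs :: "real \<Rightarrow> (real \<Rightarrow> complex) \<Rightarrow> bool" where
  "null_coeffs L h \<longleftrightarrow> per_integrable L h \<and> (\<forall>n. fourier_coeff L h n = 0)"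

lemma null_coeffs_lincomb:
  "null_coeffs L f \<Longrightarrow> null_coeffs L g \<Longrightarrow> null_coeffs L (\<lambda>x. s * f x + t * g x)"
  by (auto simp: null_coeffs_def fourier_coeff_lincomb)

lemma null_coeffs_shift:
  "null_coeffs L f \<Longrightarrow> null_coeffs L (\<lambda>x. f x * character L k x)"
  by (auto simp: null_coeffs_def fourier_coeff_shift
      intro: per_integrable_mult_continuous continuous_on_character)

text \<open>The multipliers that preserve \<^const>\<open>null_coeffs\<close> form an algebra, so Stone-Weierstrass applies
  without an explicit description of the trigonometric polynomials.\<close>

lemma null_coeffs_integral_continuous:
  fixes g :: "complex \<Rightarrow> real"
  assumes h: "null_coeffs L h" and L: "0 < L" and g: "continuous_on (sphere 0 1) g"
  shows "(LINT x:{-L..L}|lebesgue. h x * of_real (g (character L 1 x))) = 0"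
proof -
  \<comment> \<open>Quantifying over every \<open>h\<close> gives closure under products: multiply
    by one function, then apply the property of the other to the result. Continuity on the circle,
    rather than on the interval, builds in periodicity.\<close>
  define P where "P = (\<lambda>g :: complex \<Rightarrow> real. continuous_on (sphere 0 1) g \<and>
    (\<forall>h. null_coeffs L h \<longrightarrow> null_coeffs L (\<lambda>x. h x * of_real (g (character L 1 x)))))"
  have comp: "continuous_on UNIV (\<lambda>x. complex_of_real (g (character L 1 x)))"
    if "continuous_on (sphere 0 1) g" for g :: "complex \<Rightarrow> real"
    by (intro continuous_intros continuous_on_compose2[OF that continuous_on_character]) auto
  have ReP: "P Re"
    unfolding P_def
  proof (intro conjI allI impI)
    show "continuous_on (sphere 0 1) Re" by (intro continuous_intros)
    fix h assume h: "null_coeffs L h"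
    have "null_coeffs L (\<lambda>x. 1 / 2 * (h x * character L 1 x) + 1 / 2 * (h x * character L (- 1) x))"
      by (intro null_coeffs_lincomb null_coeffs_shift h)
    moreover have "1 / 2 * (h x * character L 1 x) + 1 / 2 * (h x * character L (- 1) x) = h x * of_real (Re (character L 1 x))" for x
      by (simp add: complex_eq_iff character_def field_simps)
    ultimately show "null_coeffs L (\<lambda>x. h x * of_real (Re (character L 1 x)))" by simp
  qed
  have ImP: "P Im"
    unfolding P_def
  proof (intro conjI allI impI)
    show "continuous_on (sphere 0 1) Im" by (intro continuous_intros)
    fix h assume h: "null_coeffs L h"
    have "null_coeffs L (\<lambda>x. - \<i> / 2 * (h x * character L 1 x) + \<i> / 2 * (h x * character L (- 1) x))"
      by (intro null_coeffs_lincomb null_coeffs_shift h)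
    moreover have "- \<i> / 2 * (h x * character L 1 x) + \<i> / 2 * (h x * character L (- 1) x) = h x * of_real (Im (character L 1 x))" for x
      by (simp add: complex_eq_iff character_def field_simps)
    ultimately show "null_coeffs L (\<lambda>x. h x * of_real (Im (character L 1 x)))" by simp
  qed
  have approx: "\<exists>q. P q \<and> (\<forall>z\<in>sphere 0 1. \<bar>g z - q z\<bar> < e)" if "0 < e" for e
  proof (rule Stone_Weierstrass_HOL[where P = P and S = "sphere 0 1" and f = g and e = e])
    show "compact (sphere (0::complex) 1)" by simp
    show "P (\<lambda>x. c)" for c
      unfolding P_def using null_coeffs_lincomb[of L h h "of_real c" 0 for h]
      by (auto simp: mult.commute intro!: continuous_intros)
    show "continuous_on (sphere 0 1) f" if "P f" for f using that by (simp add: P_def)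
    show "P (\<lambda>x. f x + g x)" if "P f \<and> P g" for f g
      unfolding P_def
    proof (intro conjI allI impI)
      show "continuous_on (sphere 0 1) (\<lambda>x. f x + g x)"
        using that by (auto simp: P_def intro!: continuous_intros)
      fix h assume "null_coeffs L h"
      hence "null_coeffs L (\<lambda>x. 1 * (h x * of_real (f (character L 1 x))) + 1 * (h x * of_real (g (character L 1 x))))"
        using that by (intro null_coeffs_lincomb) (auto simp: P_def)
      thus "null_coeffs L (\<lambda>x. h x * of_real (f (character L 1 x) + g (character L 1 x)))"
        by (simp add: distrib_left)
    qed
    show "P (\<lambda>x. f x * g x)" if "P f \<and> P g" for f g
      unfolding P_def
    proof (intro conjI allI impI)
      show "continuous_on (sphere 0 1) (\<lambda>x. f x * g x)"
        using that by (auto simp: P_def intro!: continuous_intros)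
      fix h assume "null_coeffs L h"
      hence "null_coeffs L (\<lambda>x. (h x * of_real (f (character L 1 x))) * of_real (g (character L 1 x)))"
        using that by (auto simp: P_def)
      thus "null_coeffs L (\<lambda>x. h x * of_real (f (character L 1 x) * g (character L 1 x)))"
        by (simp add: mult.assoc)
    qed
    show "\<exists>f. P f \<and> f x \<noteq> f y" if "x \<in> sphere 0 1 \<and> y \<in> sphere 0 1 \<and> x \<noteq> y" for x y
      using that ReP ImP complex_eq_iff by blast
  qed (use g that in auto)
  have hI: "per_integrable L h" using h by (simp add: null_coeffs_def)
  define N where "N = (LINT x:{-L..L}|lebesgue. norm (h x))"
  have small: "norm (LINT x:{-L..L}|lebesgue. h x * of_real (g (character L 1 x))) \<le> e * N" if e: "0 < e" for e
  proof -
    obtain q where q: "P q" "\<And>z. z \<in> sphere 0 1 \<Longrightarrow> \<bar>g z - q z\<bar> < e"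
      using approx[OF e] by blast
    have qc: "continuous_on (sphere 0 1) q" using q by (simp add: P_def)
    have "null_coeffs L (\<lambda>x. h x * of_real (q (character L 1 x)))"
      using q(1) h by (simp add: P_def)
    hence q0: "(LINT x:{-L..L}|lebesgue. h x * of_real (q (character L 1 x))) = 0"
      using L by (auto simp: null_coeffs_def fourier_coeff_character dest!: spec[of _ 0])
    have "(LINT x:{-L..L}|lebesgue. h x * of_real (g (character L 1 x)))
        = (LINT x:{-L..L}|lebesgue. h x * of_real (g (character L 1 x)) - h x * of_real (q (character L 1 x)))"
      using set_integral_diff(2)[OF per_integrable_mult_continuous[OF hI comp[OF g]] per_integrable_mult_continuous[OF hI comp[OF qc]]] q0
      by simp
    also have "\<dots> = (LINT x:{-L..L}|lebesgue. h x * (of_real (g (character L 1 x)) - of_real (q (character L 1 x))))"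
      by (simp add: right_diff_distrib)
    also have "norm \<dots> \<le> e * N"
      unfolding N_def
    proof (rule set_integral_mult_bound[OF hI])
      show "continuous_on UNIV (\<lambda>x. complex_of_real (g (character L 1 x)) - of_real (q (character L 1 x)))"
        by (intro continuous_on_diff comp g qc)
      fix x
      have "norm (complex_of_real (g (character L 1 x)) - of_real (q (character L 1 x))) = \<bar>g (character L 1 x) - q (character L 1 x)\<bar>"
        by (metis norm_of_real of_real_diff)
      thus "norm (complex_of_real (g (character L 1 x)) - of_real (q (character L 1 x))) \<le> e"
        using q(2)[of "character L 1 x"] by simp
    qed
    finally show ?thesis .
  qed
  have "norm (LINT x:{-L..L}|lebesgue. h x * of_real (g (character L 1 x))) \<le> 0"
  proof (rule field_le_epsilon)
    fix e :: real assume e: "0 < e"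
    have N: "0 \<le> N" unfolding N_def set_lebesgue_integral_def by (intro integral_nonneg_AE) auto
    have "norm (LINT x:{-L..L}|lebesgue. h x * of_real (g (character L 1 x))) \<le> e / (N + 1) * N"
      using small[of "e / (N + 1)"] e N by simp
    also have "\<dots> \<le> 0 + e" using e N by (simp add: field_simps)
    finally show "norm (LINT x:{-L..L}|lebesgue. h x * of_real (g (character L 1 x))) \<le> 0 + e" .
  qed
  thus ?thesis by simp
qed

lemma AE_lebesgue_not_singleton: "AE x in lebesgue. x \<noteq> (c::real)"
  by (rule AE_completion[OF AE_lborel_singleton])

text \<open>The points differ by a multiple of \<open>2 L\<close>. Since \<open>-L\<close> and
  \<open>L\<close> have the same image, one of the two points has to be interior.\<close>

lemma character_1_eq_imp:
  assumes "0 < L" "- L < x" "x < L" "- L \<le> y" "y \<le> L" "character L 1 x = character L 1 y"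
  shows "x = y"
proof -
  obtain k :: int where k: "pi * x / L = pi * y / L + 2 * pi * k"
    using assms(6) sin_cos_eq_iff[of "pi * x / L" "pi * y / L"]
    by (auto simp: character_def complex_eq_iff)
  have "pi * (x / L) = pi * (y / L + 2 * k)" using k by (simp add: algebra_simps)
  hence "x / L = y / L + 2 * k" by (metis mult_cancel_left pi_neq_zero)
  hence e: "x - y = 2 * L * k" using assms(1) by (simp add: field_simps)
  have "\<bar>x - y\<bar> < 2 * L * 1" using assms by linarith
  hence "\<bar>real_of_int k\<bar> < 1" unfolding e using assms(1) by (simp add: abs_mult)
  hence "k = 0" by linarith
  thus ?thesis using e by simp
qed

text \<open>The indicator of \<open>A\<close> is the almost everywhere limit of the cut-offs
  \<open>max 0 (1 - j * infdist z K)\<close> on the circle, where \<open>K\<close> is the image of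
  \<open>A\<close>; dominated convergence carries over the vanishing of the integrals.\<close>

lemma null_coeffs_integral_closed:
  assumes h: "null_coeffs L h" and L: "0 < L" and A: "closed A" "A \<subseteq> {-L..L}"
  shows "(LINT x:A|lebesgue. h x) = 0"
proof (cases "A = {}")
  case True
  thus ?thesis by (simp add: set_lebesgue_integral_def)
next
  case False
  define K where "K = character L 1 ` A"
  have "compact A" using A by (metis bounded_closed_interval bounded_subset compact_eq_bounded_closed)
  hence K: "closed K" "K \<noteq> {}"
    unfolding K_def using False by (auto intro!: compact_imp_closed compact_continuous_image continuous_on_character)
  define g where "g = (\<lambda>(j::nat) z. max 0 (1 - real j * infdist z K))"
  have g: "(LINT x:{-L..L}|lebesgue. h x * of_real (g j (character L 1 x))) = 0" for j
    by (rule null_coeffs_integral_continuous[OF h L]) (auto simp: g_def intro!: continuous_intros)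
  have hI: "per_integrable L h" using h by (simp add: null_coeffs_def)
  have gcont: "continuous_on UNIV (\<lambda>x. complex_of_real (g j (character L 1 x)))" for j
    unfolding g_def by (intro continuous_intros)
  have g01: "\<bar>g j z\<bar> \<le> 1" for j z by (auto simp: g_def infdist_nonneg)
  have "(\<lambda>j. \<integral>x. indicator {-L..L} x *\<^sub>R (h x * of_real (g j (character L 1 x))) \<partial>lebesgue)
      \<longlonglongrightarrow> (\<integral>x. indicator A x *\<^sub>R h x \<partial>lebesgue)"
  proof (rule integral_dominated_convergence[where w="\<lambda>x. norm (indicator {-L..L} x *\<^sub>R h x)"])
    show "(\<lambda>x. indicator A x *\<^sub>R h x) \<in> borel_measurable lebesgue"
      using set_integrable_subset[OF hI _ A(2)] A(1)
      unfolding set_integrable_def by (intro borel_measurable_integrable) (auto simp: borel_closed)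
    show "(\<lambda>x. indicator {-L..L} x *\<^sub>R (h x * of_real (g j (character L 1 x)))) \<in> borel_measurable lebesgue" for j
      using per_integrable_mult_continuous[OF hI gcont] unfolding set_integrable_def
      by (rule borel_measurable_integrable)
    show "integrable lebesgue (\<lambda>x. norm (indicator {-L..L} x *\<^sub>R h x))"
      using hI unfolding set_integrable_def by (rule integrable_norm)
    show "AE x in lebesgue. norm (indicator {-L..L} x *\<^sub>R (h x * of_real (g j (character L 1 x)))) \<le> norm (indicator {-L..L} x *\<^sub>R h x)" for j
      using g01 by (intro AE_I2) (auto simp: indicator_def norm_mult mult_left_le)
    \<comment> \<open>The endpoints are discarded: one of them may map into \<open>K\<close> without
      lying in \<open>A\<close>.\<close>
    show "AE x in lebesgue. (\<lambda>j. indicator {-L..L} x *\<^sub>R (h x * of_real (g j (character L 1 x)))) \<longlonglongrightarrow> indicator A x *\<^sub>R h x"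
      using AE_lebesgue_not_singleton[of L] AE_lebesgue_not_singleton[of "- L"]
    proof eventually_elim
      case (elim x)
      show ?case
      proof (cases "x \<in> {-L..L}")
        case False
        thus ?thesis using A by (auto simp: indicator_def)
      next
        case True
        have lim: "(\<lambda>j. g j (character L 1 x)) \<longlonglongrightarrow> indicator A x"
        proof (cases "x \<in> A")
          case True
          hence "infdist (character L 1 x) K = 0" by (simp add: K_def)
          thus ?thesis using True by (simp add: g_def)
        next
          case False
          have "character L 1 x \<notin> K"
          proof
            assume "character L 1 x \<in> K"
            then obtain y where "y \<in> A" "character L 1 x = character L 1 y" by (auto simp: K_def)
            hence "x = y" using A(2) elim True by (intro character_1_eq_imp[OF L]) auto
            thus False using \<open>y \<in> A\<close> False by simp
          qed
          hence d: "0 < infdist (character L 1 x) K"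
            using in_closed_iff_infdist_zero[OF K] infdist_nonneg by (metis less_eq_real_def)
          then obtain N :: nat where N: "1 < real N * infdist (character L 1 x) K"
            using reals_Archimedean3 by blast
          have "g j (character L 1 x) = 0" if "N \<le> j" for j
          proof -
            have "real N * infdist (character L 1 x) K \<le> real j * infdist (character L 1 x) K"
              using that d by (intro mult_right_mono) auto
            thus ?thesis using N by (simp add: g_def)
          qed
          hence "eventually (\<lambda>j. g j (character L 1 x) = 0) sequentially"
            by (auto simp: eventually_sequentially)
          thus ?thesis using False by (auto intro: tendsto_eventually)
        qed
        have "(\<lambda>j. h x * of_real (g j (character L 1 x))) \<longlonglongrightarrow> h x * of_real (indicator A x)"
          by (intro tendsto_intros lim)
        thus ?thesis using True by (cases "x \<in> A") simp_all
      qed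
    qed
  qed
  hence "(\<lambda>j. 0::complex) \<longlonglongrightarrow> (LINT x:A|lebesgue. h x)"
    using g unfolding set_lebesgue_integral_def by simp
  thus ?thesis by (simp add: LIMSEQ_const_iff)
qed

text \<open>Up to a null set a Lebesgue measurable set is a countable union of closed sets, and
  finite unions turn these into an increasing sequence. The explicit indicator is the one produced
  by restricting the measure to a period.\<close>

lemma null_coeffs_integral_measurable:
  assumes h: "null_coeffs L h" and L: "0 < L" and A: "A \<in> sets lebesgue"
  shows "(LINT x:A|lebesgue. indicator {-L..L} x *\<^sub>R h x) = 0"
proof -
  have hI: "per_integrable L h" using h by (simp add: null_coeffs_def)
  have "A \<inter> {-L..L} \<in> sets lebesgue" using A by auto
  then obtain C T where CT: "fsigma C" "T \<in> null_sets lebesgue" "C \<union> T = A \<inter> {-L..L}"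
    using lebesgue_set_almost_fsigma by metis
  have "\<exists>F :: nat \<Rightarrow> real set. (\<forall>n. closed (F n)) \<and> C = \<Union> (F ` UNIV)"
    using CT(1) by cases blast
  then obtain F :: "nat \<Rightarrow> real set" where F: "\<And>n. closed (F n)" "C = \<Union> (F ` UNIV)"
    by blast
  define G where "G = (\<lambda>n. \<Union>i\<le>n. F i)"
  have FC: "F n \<subseteq> {-L..L}" for n using F CT by auto
  have G: "closed (G n)" "G n \<subseteq> {-L..L}" for n
    using F FC by (auto simp: G_def intro!: closed_UN)
  have UG: "(\<Union>n. G n) = C" unfolding G_def F(2) by auto
  have Gi: "incseq G" by (fastforce simp: incseq_def G_def)
  have Cm: "C \<in> sets lebesgue" unfolding UG[symmetric] using G(1) by (auto intro!: borel_closed)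
  have "(\<lambda>n. LINT x:G n|lebesgue. h x) \<longlonglongrightarrow> (LINT x:(\<Union>n. G n)|lebesgue. h x)"
  proof (rule set_integral_cont_up[OF _ Gi])
    show "G i \<in> sets lebesgue" for i using G(1)[of i] by (auto intro!: borel_closed)
    show "set_integrable lebesgue (\<Union>n. G n) h"
      unfolding UG by (rule set_integrable_subset[OF hI Cm]) (use CT in auto)
  qed
  hence "(\<lambda>n. 0::complex) \<longlonglongrightarrow> (LINT x:C|lebesgue. h x)"
    unfolding UG using null_coeffs_integral_closed[OF h L G] by simp
  hence C0: "(LINT x:C|lebesgue. h x) = 0" by (simp add: LIMSEQ_const_iff)
  have "(LINT x:A|lebesgue. indicator {-L..L} x *\<^sub>R h x) = (LINT x:A \<inter> {-L..L}|lebesgue. indicator {-L..L} x *\<^sub>R h x)"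
    by (auto simp: set_lebesgue_integral_def indicator_def intro!: Bochner_Integration.integral_cong)
  also have "\<dots> = (LINT x:C|lebesgue. indicator {-L..L} x *\<^sub>R h x)"
  proof (rule set_integral_null_delta)
    show "integrable lebesgue (\<lambda>x. indicator {-L..L} x *\<^sub>R h x)"
      using hI by (simp add: set_integrable_def)
    show "A \<inter> {-L..L} - C \<union> (C - A \<inter> {-L..L}) \<in> null_sets lebesgue"
      by (rule null_sets_completion_subset[OF _ CT(2)]) (use CT(3) in auto)
  qed (use A Cm in auto)
  also have "\<dots> = (LINT x:C|lebesgue. h x)"
    using CT(3) by (auto simp: set_lebesgue_integral_def indicator_def intro!: Bochner_Integration.integral_cong)
  finally show ?thesis using C0 by simp
qed

lemma null_coeffs_AE_zero:
  assumes h: "null_coeffs L h" and L: "0 < L"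
  shows "AE x in lebesgue. x \<in> {-L..L} \<longrightarrow> h x = 0"
proof -
  have hI: "per_integrable L h" using h by (simp add: null_coeffs_def)
  interpret finite_measure "lebesgue_on {-L..L}"
    by (rule finite_measure_lebesgue_on) auto
  have "AE x in lebesgue_on {-L..L}. h x = 0"
  proof (rule density_zero)
    show "integrable (lebesgue_on {-L..L}) h"
      using hI set_integrable_eq[of "{-L..L}" lebesgue h] by simp
    fix A assume "A \<in> sets (lebesgue_on {-L..L})"
    then obtain B where "B \<in> sets lebesgue" "A = {-L..L} \<inter> B" by (auto simp: sets_restrict_space)
    hence "A \<in> sets lebesgue" by auto
    thus "set_lebesgue_integral (lebesgue_on {-L..L}) A h = 0"
      using null_coeffs_integral_measurable[OF h L] by (subst set_integral_restrict_space) auto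
  qed
  thus ?thesis by (subst (asm) AE_restrict_space_iff) auto
qed

text \<open>\<open>ae_eq\<close> refers to the whole line while the coefficients see one period;
  periodicity covers the exceptional set by countably many translates of a null set.\<close>

lemma null_coeffs_ae_eq_zero:
  assumes h: "null_coeffs L h" and L: "0 < L" and per: "\<And>x. h (x + 2 * L) = h x"
  shows "ae_eq h (\<lambda>x. 0)"
proof -
  define N where "N = {x \<in> {-L..L}. h x \<noteq> 0}"
  obtain N' where N': "\<And>x. x \<in> space lebesgue - N' \<Longrightarrow> x \<in> {-L..L} \<longrightarrow> h x = 0" "N' \<in> null_sets lebesgue"
    using AE_E3[OF null_coeffs_AE_zero[OF h L]] by blast
  have "N \<in> null_sets lebesgue"
    by (rule null_sets_completion_subset[OF _ N'(2)]) (use N'(1) in \<open>auto simp: N_def\<close>)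
  hence N: "negligible N" by (simp add: negligible_iff_null_sets)
  have per_nat: "h (x + real k * (2 * L)) = h x" for x k
    by (induction k) (use per[of "x + real k * (2 * L)" for k] in \<open>auto simp: algebra_simps\<close>)
  have per_int: "h (x + of_int k * (2 * L)) = h x" for x k
  proof (cases "0 \<le> k")
    case True
    thus ?thesis using per_nat[of x "nat k"] by simp
  next
    case False
    thus ?thesis using per_nat[of "x + of_int k * (2 * L)" "nat (- k)"] by (simp add: algebra_simps)
  qed
  have "{x. h x \<noteq> 0} \<subseteq> (\<Union>k::int. (\<lambda>x. of_int k * (2 * L) + x) ` N)"
  proof
    fix x assume x: "x \<in> {x. h x \<noteq> 0}"
    define k where "k = \<lfloor>(x + L) / (2 * L)\<rfloor>"
    define y where "y = x - of_int k * (2 * L)"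
    have "of_int k \<le> (x + L) / (2 * L)" "(x + L) / (2 * L) < of_int k + 1"
      unfolding k_def by linarith+
    hence "of_int k * (2 * L) \<le> x + L" "x + L < (of_int k + 1) * (2 * L)"
      using L by (simp_all add: pos_le_divide_eq pos_divide_less_eq)
    hence "y \<in> {-L..L}" by (simp add: y_def algebra_simps)
    moreover have "h y \<noteq> 0" using per_int[of y k] x by (simp add: y_def)
    ultimately have "y \<in> N" by (simp add: N_def)
    moreover have "x = of_int k * (2 * L) + y" by (simp add: y_def)
    ultimately show "x \<in> (\<Union>k::int. (\<lambda>x. of_int k * (2 * L) + x) ` N)" by blast
  qed
  moreover have "negligible (\<Union>k::int. (\<lambda>x. of_int k * (2 * L) + x) ` N)"
    by (intro negligible_countable_Union) (auto intro: negligible_translation N)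
  ultimately have "negligible {x. h x \<noteq> 0}" by (rule negligible_subset[rotated])
  hence "{x. h x \<noteq> 0} \<in> null_sets lebesgue" by (simp add: negligible_iff_null_sets)
  thus ?thesis unfolding ae_eq_def by (rule AE_I') auto
qed

section \<open>Coefficients modulo null sets, and differentiation\<close>

lemma fourier_coeff_cong_ae:
  assumes f: "per_integrable L f" and g: "per_integrable L g" and "ae_eq f g"
  shows "fourier_coeff L f n = fourier_coeff L g n"
proof -
  have "(LINT x:{-L..L}|lebesgue. f x * character L (- n) x) = (LINT x:{-L..L}|lebesgue. g x * character L (- n) x)"
    unfolding set_lebesgue_integral_def
  proof (rule integral_cong_AE)
    show "AE x in lebesgue. indicator {-L..L} x *\<^sub>R (f x * character L (- n) x) = indicator {-L..L} x *\<^sub>R (g x * character L (- n) x)"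
      using assms(3) unfolding ae_eq_def by eventually_elim simp
  qed (use per_integrable_mult_continuous[OF f continuous_on_character] per_integrable_mult_continuous[OF g continuous_on_character]
        in \<open>auto simp: set_integrable_def intro: borel_measurable_integrable\<close>)
  thus ?thesis by (simp add: fourier_coeff_character)
qed

lemma fourier_coeff_zero [simp]: "fourier_coeff L (\<lambda>x. 0) n = 0"
  by (simp add: fourier_coeff_def)

lemma fourier_coeff_cmult: "fourier_coeff L (\<lambda>x. s * f x) n = s * fourier_coeff L f n"
  by (simp add: fourier_coeff_def mult.assoc)

lemma ae_eq_iff_fourier_coeff:
  assumes L: "0 < L" and f: "per_integrable L f" "\<And>x. f (x + 2 * L) = f x"
    and g: "per_integrable L g" "\<And>x. g (x + 2 * L) = g x"
  shows "ae_eq f g \<longleftrightarrow> (\<forall>n. fourier_coeff L f n = fourier_coeff L g n)"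
proof
  assume "ae_eq f g"
  thus "\<forall>n. fourier_coeff L f n = fourier_coeff L g n"
    using fourier_coeff_cong_ae[OF f(1) g(1)] by blast
next
  assume eq: "\<forall>n. fourier_coeff L f n = fourier_coeff L g n"
  have "null_coeffs L (\<lambda>x. 1 * f x + (- 1) * g x)"
    unfolding null_coeffs_def using eq f(1) g(1)
    by (simp only: fourier_coeff_lincomb) auto
  hence "ae_eq (\<lambda>x. 1 * f x + (- 1) * g x) (\<lambda>x. 0)"
    by (rule null_coeffs_ae_eq_zero[OF _ L]) (simp add: f g)
  thus "ae_eq f g" by (simp add: ae_eq_def)
qed

lemma L2_per_integrable:
  assumes "f \<in> L2_per L"
  shows "per_integrable L f"
proof (rule set_integrable_bound)
  have "set_integrable lebesgue {-L..L} (\<lambda>x. 1 + (cmod (f x))\<^sup>2)"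
    by (rule set_integral_add(1)[OF absolutely_integrable_continuous_real[OF continuous_on_const]])
       (use assms in \<open>simp add: L2_per_def\<close>)
  thus "set_integrable lebesgue {-L..L} (\<lambda>x. 1 + (cmod (f x))\<^sup>2)" .
  show "set_borel_measurable lebesgue {-L..L} f"
    using assms unfolding set_borel_measurable_def L2_per_def
    by (intro borel_measurable_scaleR borel_measurable_indicator) auto
  show "AE x in lebesgue. x \<in> {-L..L} \<longrightarrow> norm (f x) \<le> norm (1 + (cmod (f x))\<^sup>2)"
  proof (intro AE_I2 impI)
    fix x
    have "0 \<le> (cmod (f x) - 1)\<^sup>2 + cmod (f x) * 1" by simp
    hence "cmod (f x) \<le> 1 + (cmod (f x))\<^sup>2" by (simp add: power2_eq_square algebra_simps)
    thus "norm (f x) \<le> norm (1 + (cmod (f x))\<^sup>2)" by simp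
  qed
qed

lemma continuous_L2_per:
  assumes c: "continuous_on UNIV f" and per: "\<And>x. f (x + 2 * L) = f x"
  shows "f \<in> L2_per L"
proof -
  have "f \<in> borel_measurable lebesgue"
    using borel_measurable_continuous_onI[OF c] by (simp add: measurable_completion)
  moreover have "set_integrable lebesgue {-L..L} (\<lambda>x. (cmod (f x))\<^sup>2)"
    by (intro absolutely_integrable_continuous_real continuous_intros continuous_on_subset[OF c]) auto
  ultimately show ?thesis using per by (simp add: L2_per_def)
qed

lemma character_has_vector_derivative:
  "(character L n has_vector_derivative (\<i> * of_real (of_int n * pi / L) * character L n x)) (at x within S)"
proof -
  have "character L n = (\<lambda>x. exp (x *\<^sub>R (\<i> * of_real (of_int n * pi / L))))"
    by (auto simp: character_def cis_conv_exp fun_eq_iff scaleR_conv_of_real mult_ac)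
  thus ?thesis
    using exp_scaleR_has_vector_derivative_right[of "\<i> * of_real (of_int n * pi / L)" x S]
    by (simp add: mult.commute)
qed

lemma fourier_coeff_derivative:
  fixes f f' :: "real \<Rightarrow> complex"
  assumes L: "0 < L" and d: "\<And>x. (f has_vector_derivative f' x) (at x)"
    and c: "continuous_on UNIV f'" and per: "\<And>x. f (x + 2 * L) = f x"
  shows "fourier_coeff L f' n = \<i> * of_real (of_int n * pi / L) * fourier_coeff L f n"
proof -
  define s where "s = \<i> * of_real (of_int n * pi / L)"
  let ?e = "character L (- n)"
  have fc: "continuous_on UNIV f"
    using d by (meson continuous_at_imp_continuous_on has_vector_derivative_continuous)
  have i: "per_integrable L (\<lambda>x. f' x * ?e x)" "per_integrable L (\<lambda>x. f x * ?e x)"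
    by (intro per_integrable_mult_continuous per_integrable_continuous c fc continuous_on_character)+
  have i3: "per_integrable L (\<lambda>x. (- s) * (f x * ?e x))"
    by (intro set_integrable_mult_right i)
  have i2: "per_integrable L (\<lambda>x. f' x * ?e x + (- s) * (f x * ?e x))"
    by (intro set_integral_add(1) i i3)
  have "((\<lambda>x. f' x * ?e x + (- s) * (f x * ?e x)) has_integral (f L * ?e L - f (- L) * ?e (- L))) {-L..L}"
  proof (rule fundamental_theorem_of_calculus)
    show "-L \<le> L" using L by simp
    fix x
    have "((\<lambda>x. f x * ?e x) has_vector_derivative (f x * (\<i> * of_real (of_int (- n) * pi / L) * ?e x) + f' x * ?e x)) (at x within {-L..L})"
      by (intro has_vector_derivative_mult has_vector_derivative_at_within[OF d] character_has_vector_derivative)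
    thus "((\<lambda>x. f x * ?e x) has_vector_derivative f' x * ?e x + (- s) * (f x * ?e x)) (at x within {-L..L})"
      by (simp add: s_def algebra_simps)
  qed
  moreover have "f L * ?e L = f (- L) * ?e (- L)"
    using per[of "- L"] character_periodic[of L "- n" "- L"] L by simp
  ultimately have "(LINT x:{-L..L}|lebesgue. f' x * ?e x + (- s) * (f x * ?e x)) = 0"
    using set_lebesgue_integral_eq_integral(2)[OF i2] by (simp add: integral_unique)
  also have "(LINT x:{-L..L}|lebesgue. f' x * ?e x + (- s) * (f x * ?e x))
      = (LINT x:{-L..L}|lebesgue. f' x * ?e x) + (- s) * (LINT x:{-L..L}|lebesgue. f x * ?e x)"
    unfolding set_integral_add(2)[OF i(1) i3] set_integral_mult_right ..
  finally have "(LINT x:{-L..L}|lebesgue. f' x * ?e x) = s * (LINT x:{-L..L}|lebesgue. f x * ?e x)"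
    by simp
  thus ?thesis unfolding fourier_coeff_character s_def[symmetric] by simp
qed

lemma fourier_coeff_one:
  assumes L: "0 < L"
  shows "fourier_coeff L (\<lambda>x. 1) n = (if n = 0 then 1 else 0)"
proof (cases "n = 0")
  case True
  have "(LINT x:{-L..L}|lebesgue. (1::complex)) = of_real (2 * L)"
    using L by (subst set_integral_const) (auto simp: scaleR_conv_of_real)
  thus ?thesis using True L by (simp add: fourier_coeff_character)
next
  case False
  \<comment> \<open>The differentiation rule for the constant 1, whose derivative is 0: the factor
    \<open>n\<close> is nonzero, so the coefficient is 0.\<close>
  have "fourier_coeff L (\<lambda>x. 0) n = \<i> * of_real (of_int n * pi / L) * fourier_coeff L (\<lambda>x. 1) n"
    by (rule fourier_coeff_derivative[OF L]) (auto intro: has_vector_derivative_const)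
  thus ?thesis using False L by simp
qed

subsection \<open>Absolutely convergent Fourier series\<close>

text \<open>Real coefficients are enough, because eigenfunctions are rebuilt from real sequences and
  only then multiplied by a complex scalar.\<close>

definition fourier_series :: "real \<Rightarrow> (int \<Rightarrow> real) \<Rightarrow> real \<Rightarrow> complex" where
  "fourier_series L z x = infsum (\<lambda>k. of_real (z k) * character L k x) UNIV"

lemma fourier_series_uniform_limit:
  assumes "z summable_on UNIV"
  shows "uniform_limit UNIV (\<lambda>X x. \<Sum>k\<in>X. of_real (z k) * character L k x) (fourier_series L z)
           (finite_subsets_at_top UNIV)"
  unfolding fourier_series_def
proof (rule Weierstrass_m_test_general)
  show "(\<lambda>k. \<bar>z k\<bar>) summable_on UNIV"
    using assms summable_on_iff_abs_summable_on_real[of z] by simp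
qed (simp add: norm_mult)

lemma continuous_on_fourier_series:
  assumes "z summable_on UNIV"
  shows "continuous_on UNIV (fourier_series L z)"
  by (rule uniform_limit_theorem[OF _ fourier_series_uniform_limit[OF assms]])
     (auto intro!: always_eventually continuous_intros)

lemma fourier_series_periodic: "L \<noteq> 0 \<Longrightarrow> fourier_series L z (x + 2 * L) = fourier_series L z x"
  by (simp add: fourier_series_def character_periodic)

text \<open>The convolution theorem for one absolutely convergent factor and one merely integrable
  factor: for finite partial sums it is linearity and frequency shift, and uniform convergence
  passes through the integral.\<close>

lemma fourier_coeff_series_mult:
  assumes L: "0 < L" and z: "z summable_on UNIV" and u: "per_integrable L u"
  shows "((\<lambda>k. of_real (z k) * fourier_coeff L u (n - k)) has_sum
            fourier_coeff L (\<lambda>x. u x * fourier_series L z x) n) UNIV"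
  unfolding has_sum_def
proof (rule tendstoI)
  fix e :: real assume e: "0 < e"
  let ?S = "\<lambda>X x. \<Sum>k\<in>X. of_real (z k) * character L k x"
  define N where "N = (LINT x:{-L..L}|lebesgue. norm (u x))"
  have N: "0 \<le> N" unfolding N_def set_lebesgue_integral_def by (intro integral_nonneg_AE) auto
  \<comment> \<open>Chosen so that the error is \<open>e * (N / (N + 1))\<close>, strictly below
    \<open>e\<close>; the added 1 also covers \<open>N = 0\<close>.\<close>
  define d where "d = e * (2 * L) / (N + 1)"
  have d: "0 < d" using e N L by (simp add: d_def)
  have part: "fourier_coeff L (\<lambda>x. u x * ?S X x) n = (\<Sum>k\<in>X. of_real (z k) * fourier_coeff L u (n - k)) \<and> per_integrable L (\<lambda>x. u x * ?S X x)"
    if "finite X" for X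
    using that
  proof (induction X)
    case (insert k X)
    have i: "per_integrable L (\<lambda>x. u x * character L k x)"
      by (intro per_integrable_mult_continuous u continuous_on_character)
    have eq: "(\<lambda>x. u x * ?S (insert k X) x) = (\<lambda>x. of_real (z k) * (u x * character L k x) + 1 * (u x * ?S X x))"
      using insert by (simp add: algebra_simps)
    show ?case
      unfolding eq using insert i
      by (auto simp: fourier_coeff_lincomb[OF i, of _ _ 1, simplified] fourier_coeff_shift intro!: set_integral_add(1))
  qed auto
  have "\<forall>\<^sub>F X in finite_subsets_at_top UNIV. \<forall>x\<in>UNIV. dist (?S X x) (fourier_series L z x) < d"
    by (rule uniform_limitD[OF fourier_series_uniform_limit[OF z] d])
  moreover have "\<forall>\<^sub>F X in finite_subsets_at_top (UNIV :: int set). finite X"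
    by (rule eventually_finite_subsets_at_top_weakI) auto
  ultimately show "\<forall>\<^sub>F X in finite_subsets_at_top UNIV. dist (\<Sum>k\<in>X. of_real (z k) * fourier_coeff L u (n - k))
      (fourier_coeff L (\<lambda>x. u x * fourier_series L z x) n) < e"
  proof eventually_elim
    case (elim X)
    have i2: "per_integrable L (\<lambda>x. u x * fourier_series L z x)"
      by (intro per_integrable_mult_continuous u continuous_on_fourier_series z)
    have "fourier_coeff L (\<lambda>x. u x * ?S X x) n - fourier_coeff L (\<lambda>x. u x * fourier_series L z x) n
        = fourier_coeff L (\<lambda>x. u x * (?S X x - fourier_series L z x)) n"
      using fourier_coeff_lincomb[OF conjunct2[OF part[OF elim(2)]] i2, of 1 "-1" n] by (simp add: right_diff_distrib)
    also have "norm \<dots> \<le> (LINT x:{-L..L}|lebesgue. norm (u x * (?S X x - fourier_series L z x))) / (2 * L)"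
      by (intro norm_fourier_coeff_le L per_integrable_mult_continuous u continuous_intros continuous_on_fourier_series z)
    also have "\<dots> \<le> (d * N) / (2 * L)"
    proof (rule divide_right_mono)
      have "(LINT x:{-L..L}|lebesgue. norm (u x * (?S X x - fourier_series L z x))) \<le> (LINT x:{-L..L}|lebesgue. d * norm (u x))"
      proof (rule set_integral_mono)
        show "set_integrable lebesgue {-L..L} (\<lambda>x. norm (u x * (?S X x - fourier_series L z x)))"
          by (intro set_integrable_norm per_integrable_mult_continuous u continuous_intros continuous_on_fourier_series z)
        show "set_integrable lebesgue {-L..L} (\<lambda>x. d * norm (u x))"
          using set_integrable_norm[OF u] by simp
        show "norm (u x * (?S X x - fourier_series L z x)) \<le> d * norm (u x)" for x
          unfolding norm_mult mult.commute[of "norm (u x)"]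
          using elim(1) by (intro mult_right_mono) (auto simp: dist_norm less_imp_le)
      qed
      thus "(LINT x:{-L..L}|lebesgue. norm (u x * (?S X x - fourier_series L z x))) \<le> d * N"
        by (simp add: N_def)
    qed (use L in simp)
    also have "\<dots> = e * (N / (N + 1))"
      using L by (simp add: d_def)
    also have "\<dots> < e * 1"
      using e N by (intro mult_strict_left_mono) auto
    finally show ?case using part[OF elim(2)] by (simp add: dist_norm)
  qed
qed

lemma fourier_coeff_series:
  assumes L: "0 < L" and z: "z summable_on UNIV"
  shows "fourier_coeff L (fourier_series L z) n = of_real (z n)"
proof -
  have "((\<lambda>k. of_real (z k) * fourier_coeff L (\<lambda>x. 1) (n - k)) has_sum
            fourier_coeff L (\<lambda>x. 1 * fourier_series L z x) n) UNIV"
    by (rule fourier_coeff_series_mult[OF L z per_integrable_continuous]) auto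
  moreover have "((\<lambda>k. of_real (z k) * fourier_coeff L (\<lambda>x. 1) (n - k)) has_sum of_real (z n)) UNIV"
    by (rule has_sum_finite_neutralI[where B="{n}"]) (auto simp: fourier_coeff_one[OF L])
  ultimately show ?thesis using has_sum_unique by fastforce
qed

text \<open>By uniqueness \<open>g\<close> agrees almost everywhere with the series of its summable
  coefficients, so the convolution theorem for series applies to it.\<close>

lemma fourier_coeff_mult:
  assumes L: "0 < L" and g: "continuous_on UNIV g" "\<And>x. g (x + 2 * L) = g x"
    and a: "\<And>n. fourier_coeff L g n = of_real (a n)" "a summable_on UNIV"
    and u: "per_integrable L u"
  shows "((\<lambda>k. of_real (a (n - k)) * fourier_coeff L u k) has_sum fourier_coeff L (\<lambda>x. g x * u x) n) UNIV"
proof -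
  have "ae_eq g (fourier_series L a)"
    using L by (subst ae_eq_iff_fourier_coeff)
      (auto intro!: per_integrable_continuous g continuous_on_fourier_series a(2)
            simp: fourier_series_periodic fourier_coeff_series a g)
  hence "ae_eq (\<lambda>x. u x * g x) (\<lambda>x. u x * fourier_series L a x)"
    unfolding ae_eq_def by eventually_elim simp
  hence "fourier_coeff L (\<lambda>x. g x * u x) n = fourier_coeff L (\<lambda>x. u x * fourier_series L a x) n"
    unfolding mult.commute[of "g _"]
    by (intro fourier_coeff_cong_ae per_integrable_mult_continuous u g continuous_on_fourier_series a)
  hence "((\<lambda>k. of_real (a k) * fourier_coeff L u (n - k)) has_sum fourier_coeff L (\<lambda>x. g x * u x) n) UNIV"
    using fourier_coeff_series_mult[OF L a(2) u, of n] by simp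
  thus ?thesis
    by (subst has_sum_reindex_bij_witness[where i="\<lambda>k. n - k" and j="\<lambda>k. n - k" and T=UNIV
          and h="\<lambda>k. of_real (a k) * fourier_coeff L u (n - k)"]) auto
qed

text \<open>For real coefficients this is evenness, which is how the symmetry of the kernel
  \<open>a (n - k)\<close> arises.\<close>

lemma fourier_coeff_real_minus:
  "fourier_coeff L (\<lambda>x. of_real (f x)) (- n) = cnj (fourier_coeff L (\<lambda>x. of_real (f x)) n)"
proof -
  have "cnj (LINT x:{-L..L}|lebesgue. of_real (f x) * character L (- n) x)
      = (LINT x:{-L..L}|lebesgue. of_real (f x) * character L n x)"
    unfolding set_lebesgue_integral_def Bochner_Integration.integral_cnj[symmetric]
    by (intro Bochner_Integration.integral_cong) (auto simp: character_def cis_cnj scaleR_conv_of_real)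
  thus ?thesis by (simp add: fourier_coeff_character)
qed

section \<open>The linearised operator in Fourier variables\<close>

lemma multiplier_image:
  assumes "u \<in> multiplier_domain L \<alpha>"
  shows "is_multiplier_image L \<alpha> u (multiplier L \<alpha> u)"
proof -
  obtain v where "is_multiplier_image L \<alpha> u v"
    using assms by (auto simp: multiplier_domain_def)
  thus ?thesis unfolding multiplier_def by (rule someI[where P = "is_multiplier_image L \<alpha> u"])
qed

text \<open>The dictionary between functions and sequences. Positivity and total positivity belong
  to \<open>wave_sequences\<close>; here \<open>a\<close> has to be summable, so that multiplication
  by \<open>\<phi> ^ p\<close> is a convolution.\<close>

locale periodic_linearization =
  fixes L c :: real and p :: nat and \<alpha> \<phi> :: "real \<Rightarrow> real" and a :: "int \<Rightarrow> real"
  assumes L_pos: "0 < L"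
    and phi_cont: "continuous_on UNIV \<phi>" and phi_per: "\<And>x. \<phi> (x + 2 * L) = \<phi> x"
    and a_coeff: "\<And>n. fourier_coeff L (\<lambda>x. of_real (\<phi> x ^ p)) n = of_real (a n)"
    and a_summable: "a summable_on UNIV"
begin

abbreviation G :: "real \<Rightarrow> complex" where
  "G x \<equiv> of_real (\<phi> x ^ p)"

abbreviation w :: "int \<Rightarrow> real" where
  "w n \<equiv> c * \<alpha> (of_int n) + c - 1"

abbreviation dom :: "(real \<Rightarrow> complex) set" where
  "dom \<equiv> multiplier_domain L \<alpha>"

abbreviation lin_op :: "(real \<Rightarrow> complex) \<Rightarrow> real \<Rightarrow> complex" where
  "lin_op \<equiv> linearized_op L \<alpha> p c \<phi>"

lemma G_cont: "continuous_on UNIV G"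
  by (intro continuous_intros phi_cont)

lemma G_per: "G (x + 2 * L) = G x"
  by (simp add: phi_per)

lemma fourier_coeff_G_mult:
  assumes "per_integrable L u"
  shows "((\<lambda>k. of_real (a (n - k)) * fourier_coeff L u k) has_sum fourier_coeff L (\<lambda>x. G x * u x) n) UNIV"
  by (rule fourier_coeff_mult[OF L_pos G_cont G_per a_coeff a_summable assms])

lemma G_mult_integrable: "per_integrable L u \<Longrightarrow> per_integrable L (\<lambda>x. G x * u x)"
  using per_integrable_mult_continuous[OF _ G_cont] by (simp add: mult.commute)

text \<open>On \<open>dom\<close> the chosen value of \<open>multiplier\<close> has prescribed
  coefficients, so both sides are integrable periodic functions with known coefficients and
  uniqueness makes the two equations equivalent.\<close>

lemma eigen_equation_iff:
  assumes u: "u \<in> dom"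
  shows "ae_eq (lin_op u) (\<lambda>x. of_real \<mu> * u x) \<longleftrightarrow>
    (\<forall>n. ((\<lambda>k. of_real (a (n - k)) * fourier_coeff L u k) has_sum of_real (w n - \<mu>) * fourier_coeff L u n) UNIV)"
proof -
  define v where "v = multiplier L \<alpha> u"
  have v: "v \<in> L2_per L" "\<And>n. fourier_coeff L v n = of_real (\<alpha> (of_int n)) * fourier_coeff L u n"
    using multiplier_image[OF u] by (auto simp: v_def is_multiplier_image_def)
  have u2: "u \<in> L2_per L" using u by (simp add: multiplier_domain_def)
  have ui: "per_integrable L u" and vi: "per_integrable L v"
    using L2_per_integrable u2 v(1) by auto
  have per: "u (x + 2 * L) = u x" "v (x + 2 * L) = v x" for x
    using u2 v(1) by (auto simp: L2_per_def)
  note Gi = G_mult_integrable[OF ui]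
  have T: "lin_op u = (\<lambda>x. 1 * (of_real c * v x + of_real (c - 1) * u x) + (- 1) * (G x * u x))"
    by (simp add: linearized_op_def v_def)
  have i1: "per_integrable L (\<lambda>x. of_real c * v x + of_real (c - 1) * u x)"
    by (intro set_integral_add(1) set_integrable_mult_right ui vi)
  have Ti: "per_integrable L (lin_op u)"
    unfolding T by (intro set_integral_add(1) set_integrable_mult_right i1 Gi)
  have coeff: "fourier_coeff L (lin_op u) n = of_real (w n) * fourier_coeff L u n - fourier_coeff L (\<lambda>x. G x * u x) n" for n
    unfolding T fourier_coeff_lincomb[OF i1 Gi] fourier_coeff_lincomb[OF vi ui]
    by (simp add: v algebra_simps)
  have iff: "X = Y \<longleftrightarrow> (f has_sum Y) UNIV" if "(f has_sum X) UNIV" for f :: "int \<Rightarrow> complex" and X Y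
    using that by (auto dest: has_sum_unique)
  have "ae_eq (lin_op u) (\<lambda>x. of_real \<mu> * u x) \<longleftrightarrow>
      (\<forall>n. fourier_coeff L (lin_op u) n = of_real \<mu> * fourier_coeff L u n)"
    unfolding fourier_coeff_cmult[symmetric]
    by (rule ae_eq_iff_fourier_coeff[OF L_pos Ti])
       (auto simp: linearized_op_def per phi_per v_def[symmetric] intro: ui set_integrable_mult_right)
  also have "\<dots> \<longleftrightarrow> (\<forall>n. fourier_coeff L (\<lambda>x. G x * u x) n = of_real (w n - \<mu>) * fourier_coeff L u n)"
    unfolding coeff by (auto simp: algebra_simps)
  also have "\<dots> \<longleftrightarrow> (\<forall>n. ((\<lambda>k. of_real (a (n - k)) * fourier_coeff L u k) has_sum of_real (w n - \<mu>) * fourier_coeff L u n) UNIV)"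
  proof (rule all_cong1)
    fix n
    show "fourier_coeff L (\<lambda>x. G x * u x) n = of_real (w n - \<mu>) * fourier_coeff L u n \<longleftrightarrow>
        ((\<lambda>k. of_real (a (n - k)) * fourier_coeff L u k) has_sum of_real (w n - \<mu>) * fourier_coeff L u n) UNIV"
      by (rule iff[OF fourier_coeff_G_mult[OF ui]])
  qed
  finally show ?thesis .
qed

text \<open>The kernel, the weight and \<mu> are real, so real and imaginary parts decouple; by
  uniqueness they cannot both vanish.\<close>

lemma eigenfunction_sequences:
  assumes e: "eigenfunction dom lin_op \<mu> u"
  defines "x \<equiv> \<lambda>n. Re (fourier_coeff L u n)" and "y \<equiv> \<lambda>n. Im (fourier_coeff L u n)"
  shows "((\<lambda>k. a (n - k) * x k) has_sum (w n - \<mu>) * x n) UNIV"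
    and "((\<lambda>k. a (n - k) * y k) has_sum (w n - \<mu>) * y n) UNIV"
    and "\<exists>B. \<forall>n. \<bar>x n\<bar> \<le> B" and "\<exists>B. \<forall>n. \<bar>y n\<bar> \<le> B"
    and "\<exists>m. x m \<noteq> 0 \<or> y m \<noteq> 0"
proof -
  have u: "u \<in> dom" "\<not> ae_eq u (\<lambda>x. 0)" "ae_eq (lin_op u) (\<lambda>x. of_real \<mu> * u x)"
    using e by (auto simp: eigenfunction_def)
  have u2: "u \<in> L2_per L" using u by (simp add: multiplier_domain_def)
  hence ui: "per_integrable L u" and per: "\<And>x. u (x + 2 * L) = u x"
    by (auto simp: L2_per_integrable L2_per_def)
  have s: "((\<lambda>k. of_real (a (n - k)) * fourier_coeff L u k) has_sum of_real (w n - \<mu>) * fourier_coeff L u n) UNIV"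
    using u eigen_equation_iff by blast
  show "((\<lambda>k. a (n - k) * x k) has_sum (w n - \<mu>) * x n) UNIV"
    using has_sum_Re[OF s] by (simp add: x_def)
  show "((\<lambda>k. a (n - k) * y k) has_sum (w n - \<mu>) * y n) UNIV"
    using has_sum_Im[OF s] by (simp add: y_def)
  have b: "norm (fourier_coeff L u n) \<le> (LINT x:{-L..L}|lebesgue. norm (u x)) / (2 * L)" for n
    by (rule norm_fourier_coeff_le[OF ui L_pos])
  show "\<exists>B. \<forall>n. \<bar>x n\<bar> \<le> B" "\<exists>B. \<forall>n. \<bar>y n\<bar> \<le> B"
    using b abs_Re_le_cmod abs_Im_le_cmod order_trans unfolding x_def y_def by blast+
  show "\<exists>m. x m \<noteq> 0 \<or> y m \<noteq> 0"
  proof (rule ccontr)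
    assume "\<not> ?thesis"
    hence "fourier_coeff L u n = fourier_coeff L (\<lambda>x. 0) n" for n
      by (auto simp: x_def y_def complex_eq_iff)
    hence "ae_eq u (\<lambda>x. 0)"
      using ae_eq_iff_fourier_coeff[OF L_pos ui per, of "\<lambda>x. 0"] by simp
    thus False using u by simp
  qed
qed

lemma fourier_series_eigenfunction:
  assumes c: "c \<noteq> 0" and z: "z summable_on UNIV"
    and eq: "\<And>n. ((\<lambda>k. a (n - k) * z k) has_sum (w n - \<mu>) * z n) UNIV"
    and nz: "z m \<noteq> 0"
  shows "eigenfunction dom lin_op \<mu> (fourier_series L z)"
proof -
  let ?u = "fourier_series L z"
  have L0: "L \<noteq> 0" using L_pos by simp
  note uc = continuous_on_fourier_series[OF z, of L] and up = fourier_series_periodic[OF L0, of z]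
  note u_coeff = fourier_coeff_series[OF L_pos z]
  have ui: "per_integrable L ?u" by (rule per_integrable_continuous[OF uc])
  have eqc: "((\<lambda>k. of_real (a (n - k)) * fourier_coeff L ?u k) has_sum of_real (w n - \<mu>) * fourier_coeff L ?u n) UNIV" for n
    using has_sum_of_real[OF eq[of n], where 'a = complex] by (simp add: u_coeff)
  have Gu: "fourier_coeff L (\<lambda>x. G x * ?u x) n = of_real (w n - \<mu>) * of_real (z n)" for n
    using has_sum_unique[OF fourier_coeff_G_mult[OF ui] eqc] by (simp add: u_coeff)
  \<comment> \<open>The eigenvalue equation solved for the multiplier, which is possible as
    \<open>c \<noteq> 0\<close>. Its continuity exhibits an image in \<open>L2_per\<close>, and so
    puts the series into the domain.\<close>
  define v where "v = (\<lambda>x. of_real (1 / c) * (G x * ?u x) + of_real ((\<mu> - c + 1) / c) * ?u x)"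
  have "v \<in> L2_per L"
    unfolding v_def by (rule continuous_L2_per) (auto intro!: continuous_intros phi_cont uc simp: up phi_per c)
  moreover have "fourier_coeff L v n = of_real (\<alpha> (of_int n)) * fourier_coeff L ?u n" for n
  proof -
    have "fourier_coeff L v n = of_real (1 / c * ((w n - \<mu>) * z n) + (\<mu> - c + 1) / c * z n)"
      unfolding v_def fourier_coeff_lincomb[OF G_mult_integrable[OF ui] ui] Gu u_coeff by simp
    also have "1 / c * ((w n - \<mu>) * z n) + (\<mu> - c + 1) / c * z n = \<alpha> (of_int n) * z n"
      using c by (simp add: field_simps)
    finally show ?thesis by (simp add: u_coeff)
  qed
  ultimately have dom: "?u \<in> dom"
    using continuous_L2_per[OF uc up] by (auto simp: multiplier_domain_def is_multiplier_image_def)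
  have "\<not> ae_eq ?u (\<lambda>x. 0)"
    using ae_eq_iff_fourier_coeff[OF L_pos ui up, of "\<lambda>x. 0"] nz by (auto simp: u_coeff)
  thus ?thesis
    using dom eqc eigen_equation_iff[OF dom] by (simp add: eigenfunction_def)
qed

text \<open>The two real factors combine into the scalar \<open>Complex k1 k2\<close>, as simplicity
  over the complex numbers demands.\<close>

lemma eigenfunction_proportional:
  assumes "eigenfunction dom lin_op \<mu> u" "z summable_on UNIV"
    and "\<And>n. Re (fourier_coeff L u n) = k1 * z n" "\<And>n. Im (fourier_coeff L u n) = k2 * z n"
  shows "\<exists>k. ae_eq u (\<lambda>x. k * fourier_series L z x)"
proof -
  have u2: "u \<in> L2_per L" using assms(1) by (simp add: eigenfunction_def multiplier_domain_def)
  hence ui: "per_integrable L u" and per: "\<And>x. u (x + 2 * L) = u x"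
    by (auto simp: L2_per_integrable L2_per_def)
  have "ae_eq u (\<lambda>x. Complex k1 k2 * fourier_series L z x)"
  proof (subst ae_eq_iff_fourier_coeff[OF L_pos ui per])
    show "per_integrable L (\<lambda>x. Complex k1 k2 * fourier_series L z x)"
      by (intro set_integrable_mult_right per_integrable_continuous continuous_on_fourier_series assms)
    show "\<forall>n. fourier_coeff L u n = fourier_coeff L (\<lambda>x. Complex k1 k2 * fourier_series L z x) n"
      using assms(3,4) by (simp add: fourier_coeff_cmult fourier_coeff_series[OF L_pos assms(2)] complex_eq_iff)
  qed (use L_pos in \<open>auto simp: fourier_series_periodic\<close>)
  thus ?thesis by blast
qed


text \<open>The second identity is the differentiated wave equation, obtained without
  differentiating the multiplier: the coefficients of \<open>\<phi> ^ (p + 1)\<close> are known from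
  the first identity, and its derivative \<open>(p + 1) \<phi> ^ p \<phi>'\<close> cancels the
  factor \<open>p + 1\<close>.\<close>

lemma wave_coefficients:
  assumes sol: "wave_solution L \<alpha> p c \<phi>"
    and f: "\<And>n. fourier_coeff L (\<lambda>x. of_real (\<phi> x)) n = of_real (f n)"
    and d: "\<And>x. (\<phi> has_real_derivative \<phi>' x) (at x)" and c: "continuous_on UNIV \<phi>'"
  shows "((\<lambda>k. a (n - k) * f k) has_sum real (p + 1) * w n * f n) UNIV"
    and "((\<lambda>k. a (n - k) * (real_of_int k * f k)) has_sum w n * (real_of_int n * f n)) UNIV"
proof -
  let ?u = "\<lambda>x. complex_of_real (\<phi> x)"
  define P where "P = real (p + 1)"
  have P: "P \<noteq> 0" by (simp add: P_def)
  have uc: "continuous_on UNIV ?u" by (intro continuous_intros phi_cont)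
  have up: "?u (x + 2 * L) = ?u x" for x by (simp add: phi_per)
  have ui: "per_integrable L ?u" by (rule per_integrable_continuous[OF uc])
  note Gi = G_mult_integrable[OF ui]
  define v where "v = multiplier L \<alpha> ?u"
  have u: "?u \<in> dom" using sol by (simp add: wave_solution_def)
  have v: "v \<in> L2_per L" "\<And>n. fourier_coeff L v n = of_real (\<alpha> (of_int n)) * of_real (f n)"
    using multiplier_image[OF u] by (auto simp: v_def is_multiplier_image_def f)
  have vi: "per_integrable L v" by (rule L2_per_integrable[OF v(1)])
  have i1: "per_integrable L (\<lambda>x. of_real c * v x + of_real (c - 1) * ?u x)"
    by (intro set_integral_add(1) set_integrable_mult_right ui vi)
  let ?E = "\<lambda>x. 1 * (of_real c * v x + of_real (c - 1) * ?u x) + of_real (- 1 / P) * (G x * ?u x)"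
  have Ei: "per_integrable L ?E"
    by (intro set_integral_add(1) set_integrable_mult_right i1 Gi)
  have E: "ae_eq ?E (\<lambda>x. 0)"
    using sol by (simp add: wave_solution_def v_def P_def mult.commute[of _ "complex_of_real (\<phi> _)"])
  have "fourier_coeff L ?E n = fourier_coeff L (\<lambda>x. 0) n" for n
    by (rule fourier_coeff_cong_ae[OF Ei _ E]) simp
  hence E0: "of_real c * (of_real (\<alpha> (of_int n)) * of_real (f n)) + of_real (c - 1) * of_real (f n)
      + of_real (- 1 / P) * fourier_coeff L (\<lambda>x. G x * ?u x) n = 0" for n
    unfolding fourier_coeff_lincomb[OF i1 Gi] fourier_coeff_lincomb[OF vi ui] v f by simp
  have Gu: "fourier_coeff L (\<lambda>x. G x * ?u x) n = of_real (P * w n * f n)" for n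
  proof -
    have "of_real P * (of_real (1 / P) * fourier_coeff L (\<lambda>x. G x * ?u x) n)
        = of_real P * of_real (w n * f n)"
      using E0[of n] by (simp add: algebra_simps)
    thus ?thesis using P by (simp add: mult.assoc)
  qed
  show "((\<lambda>k. a (n - k) * f k) has_sum real (p + 1) * w n * f n) UNIV"
  proof -
    have "((\<lambda>k. complex_of_real (a (n - k) * f k)) has_sum of_real (P * w n * f n)) UNIV"
      using fourier_coeff_G_mult[OF ui, of n] unfolding Gu f by simp
    thus ?thesis unfolding has_sum_of_real_iff by (simp add: P_def)
  qed
  let ?u' = "\<lambda>x. complex_of_real (\<phi>' x)"
  have uc': "continuous_on UNIV ?u'" by (intro continuous_intros c)
  have ui': "per_integrable L ?u'" by (rule per_integrable_continuous[OF uc'])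
  have u': "fourier_coeff L ?u' n = \<i> * of_real (of_int n * pi / L) * of_real (f n)" for n
    unfolding f[symmetric]
    by (rule fourier_coeff_derivative[where f = ?u, OF L_pos _ uc' up])
       (intro has_vector_derivative_of_real has_real_derivative_iff_has_vector_derivative[THEN iffD1] d)
  have "((\<lambda>x. complex_of_real (\<phi> x ^ (p + 1))) has_vector_derivative of_real (P * (\<phi> x ^ p * \<phi>' x))) (at x)" for x
  proof (intro has_vector_derivative_of_real has_real_derivative_iff_has_vector_derivative[THEN iffD1])
    show "((\<lambda>x. \<phi> x ^ (p + 1)) has_real_derivative P * (\<phi> x ^ p * \<phi>' x)) (at x)"
      using DERIV_power[OF d, of "p + 1" x] by (simp add: P_def mult_ac)
  qed
  hence "((\<lambda>x. G x * ?u x) has_vector_derivative of_real P * (G x * ?u' x)) (at x)" for x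
    by (simp add: mult.commute)
  hence dG: "fourier_coeff L (\<lambda>x. of_real P * (G x * ?u' x)) n
      = \<i> * of_real (of_int n * pi / L) * fourier_coeff L (\<lambda>x. G x * ?u x) n" for n
    by (rule fourier_coeff_derivative[where f = "\<lambda>x. G x * ?u x", OF L_pos])
       (auto intro!: continuous_intros G_cont uc' phi_cont c simp: phi_per)
  have Gu': "fourier_coeff L (\<lambda>x. G x * ?u' x) n = \<i> * of_real (of_int n * pi / L) * of_real (w n * f n)" for n
  proof -
    have "of_real P * fourier_coeff L (\<lambda>x. G x * ?u' x) n
        = of_real P * (\<i> * of_real (of_int n * pi / L) * of_real (w n * f n))"
      using dG[of n] unfolding fourier_coeff_cmult Gu mult.assoc[of P] of_real_mult[of P] by (simp only: mult_ac)
    moreover have "complex_of_real P \<noteq> 0" using P by simp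
    ultimately show ?thesis by (rule mult_left_cancel[THEN iffD1, rotated])
  qed
  \<comment> \<open>This factor removes \<open>\<i> * pi / L\<close> from the coefficients of
    \<open>\<phi>'\<close> and makes the identity real.\<close>
  have "((\<lambda>k. (- \<i> * of_real (L / pi)) * (of_real (a (n - k)) * fourier_coeff L ?u' k)) has_sum
      (- \<i> * of_real (L / pi)) * fourier_coeff L (\<lambda>x. G x * ?u' x) n) UNIV"
    by (intro has_sum_cmult_right fourier_coeff_G_mult ui')
  moreover have "(- \<i> * of_real (L / pi)) * (of_real (a (n - k)) * fourier_coeff L ?u' k)
      = complex_of_real (a (n - k) * (real_of_int k * f k))" for k
    using L_pos unfolding u' by (simp add: complex_eq_iff)
  moreover have "(- \<i> * of_real (L / pi)) * fourier_coeff L (\<lambda>x. G x * ?u' x) n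
      = complex_of_real (w n * (real_of_int n * f n))"
    using L_pos unfolding Gu' by (simp add: complex_eq_iff)
  ultimately have "((\<lambda>k. complex_of_real (a (n - k) * (real_of_int k * f k))) has_sum
      of_real (w n * (real_of_int n * f n))) UNIV"
    by simp
  thus "((\<lambda>k. a (n - k) * (real_of_int k * f k)) has_sum w n * (real_of_int n * f n)) UNIV"
    unfolding has_sum_of_real_iff .
qed

end

section \<open>Growth of the dispersion weight\<close>

lemma admissible_symbol_lower_bound:
  assumes "admissible_symbol \<alpha>"
  shows "\<exists>A N. 0 < A \<and> (\<forall>n::int. N \<le> \<bar>real_of_int n\<bar> \<longrightarrow> A * \<bar>real_of_int n\<bar> \<le> \<alpha> (of_int n))"
proof -
  obtain m1 A n0 where A: "1 \<le> m1" "0 < A"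
      "\<And>n::int. n0 < \<bar>real_of_int n\<bar> \<Longrightarrow> A * \<bar>real_of_int n\<bar> powr m1 \<le> \<alpha> (of_int n)"
    using assms unfolding admissible_symbol_def by blast
  \<comment> \<open>The 1 makes powers monotone in the exponent, so that \<open>m1 \<ge> 1\<close>
    yields linear growth; \<open>n0 + 1\<close> turns the strict threshold into a weak one.\<close>
  have "A * \<bar>real_of_int n\<bar> \<le> \<alpha> (of_int n)" if n: "max 1 (n0 + 1) \<le> \<bar>real_of_int n\<bar>" for n :: int
  proof -
    have "\<bar>real_of_int n\<bar> powr 1 \<le> \<bar>real_of_int n\<bar> powr m1"
      using n A(1) by (intro powr_mono) auto
    hence "A * \<bar>real_of_int n\<bar> \<le> A * \<bar>real_of_int n\<bar> powr m1"
      using n A(2) by (simp add: powr_one_gt_zero_iff)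
    also have "\<dots> \<le> \<alpha> (of_int n)" using n by (intro A(3)) auto
    finally show ?thesis .
  qed
  thus ?thesis using A(2) by blast
qed

text \<open>With \<open>c \<le> 0\<close> the weight would be at most -1 at any frequency where
  \<alpha> is nonnegative. With \<open>c > 0\<close>, growth of \<alpha> handles high frequencies,
  and strict positivity handles the finitely many others through a minimum.\<close>

lemma dispersion_coercive:
  assumes \<alpha>: "admissible_symbol \<alpha>" and pos: "\<And>n::int. 0 < c * \<alpha> (of_int n) + c - 1"
  shows "0 < c" and "\<exists>C>0. \<forall>n::int. C * (1 + \<bar>real_of_int n\<bar>) \<le> c * \<alpha> (of_int n) + c - 1"
proof -
  obtain A N where A: "0 < A" "\<And>n::int. N \<le> \<bar>real_of_int n\<bar> \<Longrightarrow> A * \<bar>real_of_int n\<bar> \<le> \<alpha> (of_int n)"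
    using admissible_symbol_lower_bound[OF \<alpha>] by blast
  show c: "0 < c"
  proof (rule ccontr)
    assume "\<not> 0 < c"
    obtain n :: nat where n: "N \<le> real n" using real_arch_simple by blast
    have "0 \<le> A * real n" using A(1) by simp
    also have "\<dots> \<le> \<alpha> (of_int (int n))" using A(2)[of "int n"] n by simp
    finally have "c * \<alpha> (of_int (int n)) \<le> 0"
      using \<open>\<not> 0 < c\<close> by (simp add: mult_nonpos_nonneg)
    thus False using pos[of "int n"] \<open>\<not> 0 < c\<close> by linarith
  qed
  obtain M :: nat where M: "max N (max 1 (2 / (c * A))) \<le> real M" using real_arch_simple by blast
  define w where "w = (\<lambda>n::int. c * \<alpha> (of_int n) + c - 1)"
  define F where "F = (\<lambda>n::int. w n / (1 + \<bar>real_of_int n\<bar>)) ` {- int M..int M}"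
  \<comment> \<open>Outside the window \<open>1 + t \<le> 2 t\<close> costs a factor 2, and
    \<open>c A t \<ge> 2\<close> reserves half of \<open>c A t\<close> to absorb the -1; hence the
    quarter.\<close>
  define C where "C = min (Min F) (c * A / 4)"
  have F: "finite F" "F \<noteq> {}" by (auto simp: F_def)
  have "0 < Min F"
    using F pos by (subst Min_gr_iff) (auto simp: F_def w_def add_pos_nonneg)
  hence C: "0 < C" using c A by (simp add: C_def)
  have "C * (1 + \<bar>real_of_int n\<bar>) \<le> w n" for n
  proof (cases "\<bar>n\<bar> \<le> int M")
    case True
    hence "n \<in> {- int M..int M}" by auto
    hence "Min F \<le> w n / (1 + \<bar>real_of_int n\<bar>)"
      unfolding F_def by (intro Min_le) auto
    hence "C \<le> w n / (1 + \<bar>real_of_int n\<bar>)" by (simp add: C_def)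
    thus ?thesis by (simp add: pos_le_divide_eq add_pos_nonneg)
  next
    case False
    define t where "t = \<bar>real_of_int n\<bar>"
    have "real M \<le> t" using False by (simp add: t_def)
    hence t: "N \<le> t" "1 \<le> t" "2 / (c * A) \<le> t" using M by auto
    have cA: "0 < c * A" using c A by simp
    have "2 \<le> c * A * t" using t(3) cA by (simp add: pos_divide_le_eq mult.commute)
    have "C * (1 + t) \<le> c * A / 4 * (1 + t)"
      using t by (intro mult_right_mono) (auto simp: C_def)
    also have "\<dots> \<le> c * A / 4 * (2 * t)"
      using t cA by (intro mult_left_mono) auto
    also have "\<dots> \<le> c * A * t - 1" using \<open>2 \<le> c * A * t\<close> by (simp add: mult_ac)
    also have "\<dots> \<le> c * \<alpha> (of_int n) - 1"
      using A(2)[of n] t(1) c by (simp add: t_def mult.assoc)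
    also have "\<dots> \<le> w n" using c by (simp add: w_def)
    finally show ?thesis by (simp add: t_def)
  qed
  thus "\<exists>C>0. \<forall>n::int. C * (1 + \<bar>real_of_int n\<bar>) \<le> c * \<alpha> (of_int n) + c - 1"
    using C by (auto simp: w_def)
qed

lemma smooth_deriv:
  assumes "smooth f"
  shows "(f has_real_derivative deriv f x) (at x)" and "continuous_on UNIV (deriv f)"
proof -
  have 0: "f differentiable (at x)" for x
    using assms[unfolded smooth_def, rule_format, of 0 x] by simp
  have 1: "deriv f differentiable (at x)" for x
    using assms[unfolded smooth_def, rule_format, of 1 x] by simp
  show "(f has_real_derivative deriv f x) (at x)"
    using 0[of x] by (metis DERIV_imp_deriv real_differentiable_def)
  show "continuous_on UNIV (deriv f)"
    using 1 by (intro continuous_at_imp_continuous_on) (auto intro: differentiable_imp_continuous_within)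
qed

section \<open>From sequences back to eigenfunctions\<close>

theorem theorem8p1:
  fixes L c :: real and p :: nat and \<alpha> \<phi> :: "real \<Rightarrow> real"
  assumes L_pos: "0 < L"
    and p_ge: "1 \<le> p"
    and symbol: "admissible_symbol \<alpha>"
    and phi_pos: "\<forall>x. 0 < \<phi> x"
    and phi_even: "\<forall>x. \<phi> (- x) = \<phi> x"
    and phi_smooth: "smooth \<phi>"
    and phi_periodic: "\<forall>x. \<phi> (x + 2 * L) = \<phi> x"
    and phi_solution: "wave_solution L \<alpha> p c \<phi>"
    and phi_hat_pos: "\<forall>n. fourier_coeff L (\<lambda>x. of_real (\<phi> x)) n \<in> \<real> \<and>
                          0 < Re (fourier_coeff L (\<lambda>x. of_real (\<phi> x)) n)"
    and phi_p_hat_PF2: "\<exists>a. (\<forall>n. fourier_coeff L (\<lambda>x. of_real (\<phi> x ^ p)) n = of_real (a n)) \<and>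
                            PF2_discrete a"
  shows "(\<exists>!\<mu>. \<mu> < 0 \<and> eigenvalue (multiplier_domain L \<alpha>) (linearized_op L \<alpha> p c \<phi>) \<mu>) \<and>
         (\<forall>\<mu>. \<mu> < 0 \<and> eigenvalue (multiplier_domain L \<alpha>) (linearized_op L \<alpha> p c \<phi>) \<mu> \<longrightarrow>
              simple_eigenvalue (multiplier_domain L \<alpha>) (linearized_op L \<alpha> p c \<phi>) \<mu>) \<and>
         simple_eigenvalue (multiplier_domain L \<alpha>) (linearized_op L \<alpha> p c \<phi>) 0"
proof -
  obtain a where a: "\<And>n. fourier_coeff L (\<lambda>x. of_real (\<phi> x ^ p)) n = of_real (a n)" and PF2: "PF2_discrete a"
    using phi_p_hat_PF2 by blast
  have a_even: "a (- n) = a n" for n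
    using fourier_coeff_real_minus[of L "\<lambda>x. \<phi> x ^ p" n] unfolding a by simp
  have a_pos: "0 < a n" for n using PF2 by (simp add: PF2_discrete_def)
  have a_sum: "a summable_on UNIV"
    using PF2_moment_summable[OF PF2 a_even, of 0] by simp
  note d = smooth_deriv[OF phi_smooth]
  have cont: "continuous_on UNIV \<phi>"
    using d(1) by (meson DERIV_isCont continuous_at_imp_continuous_on)
  interpret lin: periodic_linearization L c p \<alpha> \<phi> a
    by unfold_locales (fact L_pos, fact cont, use phi_periodic in blast, fact a, fact a_sum)
  define f where "f = (\<lambda>n. Re (fourier_coeff L (\<lambda>x. of_real (\<phi> x)) n))"
  have f: "fourier_coeff L (\<lambda>x. of_real (\<phi> x)) n = of_real (f n)" for n
    using phi_hat_pos by (simp add: f_def of_real_Re)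
  have f_pos: "0 < f n" for n using phi_hat_pos by (simp add: f_def)
  define B where "B = (LINT x:{-L..L}|lebesgue. norm (complex_of_real (\<phi> x))) / (2 * L)"
  have f_bdd: "f n \<le> B" for n
  proof -
    have "f n \<le> norm (fourier_coeff L (\<lambda>x. of_real (\<phi> x)) n)"
      unfolding f_def by (rule complex_Re_le_cmod)
    also have "\<dots> \<le> B"
      unfolding B_def by (intro norm_fourier_coeff_le per_integrable_continuous continuous_intros cont L_pos)
    finally show ?thesis .
  qed
  note seq = lin.wave_coefficients[OF phi_solution f d]
  define w where "w = (\<lambda>n::int. c * \<alpha> (of_int n) + c - 1)"
  have w_eq: "c * \<alpha> (of_int n) + c - 1 = w n" for n
    by (simp add: w_def)
  have w_pos: "0 < w n" for n
  proof -
    \<comment> \<open>All terms of the convolution sum are positive, so one of them already forces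
      \<open>P w f > 0\<close>, and with it \<open>w > 0\<close>.\<close>
    have "0 < (\<Sum>k\<in>{0}. a (n - k) * f k)" using a_pos f_pos by simp
    also have "\<dots> \<le> real (p + 1) * w n * f n"
      unfolding w_def by (rule finite_sum_le_has_sum[OF seq(1)]) (use a_pos f_pos in \<open>auto intro: less_imp_le\<close>)
    finally show ?thesis using f_pos[of n] by (simp add: zero_less_mult_iff)
  qed
  note coercive = dispersion_coercive[OF symbol w_pos[unfolded w_def]]
  have c0: "c \<noteq> 0" using coercive(1) by simp
  obtain C where C: "0 < C" "\<And>n. C * (1 + \<bar>real_of_int n\<bar>) \<le> w n"
    using coercive(2) by (auto simp: w_def)
  interpret wave_sequences a w f "real (p + 1)" C B
    by unfold_locales (use PF2 a_even C p_ge f_pos f_bdd seq in \<open>auto simp: w_def\<close>)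
  have modes: "\<exists>x y. (\<forall>n. Re (fourier_coeff L u n) = x n) \<and> (\<forall>n. Im (fourier_coeff L u n) = y n) \<and>
      x \<in> form_domain \<and> res x = (\<lambda>n. \<mu> * x n) \<and> y \<in> form_domain \<and> res y = (\<lambda>n. \<mu> * y n) \<and>
      (\<exists>m. x m \<noteq> 0 \<or> y m \<noteq> 0)"
    if e: "eigenfunction lin.dom lin.lin_op \<mu> u" and \<mu>: "\<mu> \<le> 0" for \<mu> u
  proof -
    note E = lin.eigenfunction_sequences[OF e, unfolded w_eq]
    obtain X Y where XY: "\<And>n. \<bar>Re (fourier_coeff L u n)\<bar> \<le> X" "\<And>n. \<bar>Im (fourier_coeff L u n)\<bar> \<le> Y"
      using E(3,4) by blast
    note x = negative_solution_form_domain[OF \<mu> E(1) XY(1)]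
    note y = negative_solution_form_domain[OF \<mu> E(2) XY(2)]
    show ?thesis
      by (rule exI[where x = "\<lambda>n. Re (fourier_coeff L u n)"],
          rule exI[where x = "\<lambda>n. Im (fourier_coeff L u n)"]) (intro conjI allI refl x y E(5))
  qed
  have zero: "simple_eigenvalue lin.dom lin.lin_op 0"
    unfolding simple_eigenvalue_def
  proof (rule exI, intro conjI allI impI)
    note ds = form_domainD(1)[OF df_form_domain]
    \<comment> \<open>Up to a constant this series is \<open>\<phi>'\<close>. The index 1 witnesses
      that it is nonzero, since \<open>df\<close> vanishes at 0.\<close>
    show "eigenfunction lin.dom lin.lin_op 0 (fourier_series L df)"
      by (rule lin.fourier_series_eigenfunction[OF c0 ds, where m = 1]) (use seq(2) f_pos[of 1] in auto)
    fix v assume v: "eigenfunction lin.dom lin.lin_op 0 v"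
    obtain x y where xy: "\<And>n. Re (fourier_coeff L v n) = x n" "\<And>n. Im (fourier_coeff L v n) = y n"
      "x \<in> form_domain" "res x = (\<lambda>n. 0 * x n)" "y \<in> form_domain" "res y = (\<lambda>n. 0 * y n)"
      using modes[OF v] by auto
    obtain k1 where "x = (\<lambda>n. k1 * df n)" using kernel_solution[of x] xy by auto
    moreover obtain k2 where "y = (\<lambda>n. k2 * df n)" using kernel_solution[of y] xy by auto
    ultimately show "\<exists>k. ae_eq v (\<lambda>x. k * fourier_series L df x)"
      using xy by (intro lin.eigenfunction_proportional[OF v ds, of k1 k2]) auto
  qed
  obtain \<mu> z m Z where \<mu>: "\<mu> < 0" and z: "\<And>n. \<bar>z n\<bar> \<le> Z" "z m \<noteq> 0"
    "\<And>n. ((\<lambda>k. a (n - k) * z k) has_sum ((w n - \<mu>) * z n)) UNIV"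
    using negative_eigen_exists by blast
  note zD = negative_solution_form_domain[OF less_imp_le[OF \<mu>] z(3,1)]
  note zs = form_domainD(1)[OF zD(1)]
  have ez: "eigenfunction lin.dom lin.lin_op \<mu> (fourier_series L z)"
    by (rule lin.fourier_series_eigenfunction[OF c0 zs _ z(2)]) (use z(3) in \<open>simp add: w_def\<close>)
  \<comment> \<open>The eigenvalue and its eigenspace are identified together, because
    \<open>negative_eigen_unique\<close> compares any two negative eigensequences.\<close>
  have uniq: "\<nu> = \<mu> \<and> (\<exists>k. ae_eq v (\<lambda>x. k * fourier_series L z x))"
    if v: "eigenfunction lin.dom lin.lin_op \<nu> v" and \<nu>: "\<nu> < 0" for \<nu> v
  proof -
    obtain x y m' where xy: "\<And>n. Re (fourier_coeff L v n) = x n" "\<And>n. Im (fourier_coeff L v n) = y n"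
      "x \<in> form_domain" "res x = (\<lambda>n. \<nu> * x n)" "y \<in> form_domain" "res y = (\<lambda>n. \<nu> * y n)"
      and m': "x m' \<noteq> 0 \<or> y m' \<noteq> 0"
      using modes[OF v less_imp_le[OF \<nu>]] by metis
    note ux = negative_eigen_unique[OF zD \<mu> z(2) xy(3,4) \<nu>] and uy = negative_eigen_unique[OF zD \<mu> z(2) xy(5,6) \<nu>]
    have "\<nu> = \<mu>" using m' ux(2) uy(2) by blast
    moreover obtain k1 where "x = (\<lambda>n. k1 * z n)" using ux(1) by blast
    moreover obtain k2 where "y = (\<lambda>n. k2 * z n)" using uy(1) by blast
    ultimately show ?thesis
      using lin.eigenfunction_proportional[OF v zs, of k1 k2] xy(1,2) by auto
  qed
  have "\<exists>!\<mu>. \<mu> < 0 \<and> eigenvalue lin.dom lin.lin_op \<mu>"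
  proof (rule ex1I[of _ \<mu>])
    show "\<mu> < 0 \<and> eigenvalue lin.dom lin.lin_op \<mu>" using \<mu> ez by (auto simp: eigenvalue_def)
    show "\<nu> = \<mu>" if "\<nu> < 0 \<and> eigenvalue lin.dom lin.lin_op \<nu>" for \<nu>
      using that uniq by (auto simp: eigenvalue_def)
  qed
  moreover have "simple_eigenvalue lin.dom lin.lin_op \<nu>"
    if "\<nu> < 0 \<and> eigenvalue lin.dom lin.lin_op \<nu>" for \<nu>
  proof -
    have "\<nu> = \<mu>" using that uniq by (auto simp: eigenvalue_def)
    thus ?thesis using ez uniq[OF _ \<mu>] by (auto simp: simple_eigenvalue_def)
  qed
  ultimately show ?thesis using zero by blast
qed

end
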